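(* Let $M$ be a smooth manifold of dimension $n$ ($n\ge 2$), let $\mathbf{G}$ be a spray on $M$ and let $dV$ be a volume form on $M$. Then the Berwald-Weyl curvature $\mathbf{W}^{o}=W^o_k\,dx^k$ of $(\mathbf{G},dV)$ is given by $$W^{o}_{k}=R_{|k}-\frac{1}{2}R_{\cdot k|m}y^{m}-\frac{1}{n+1}\chi_{k|m}y^{m}-\frac{1}{n+1}W^{m}_{~k}\mathbf{S}_{\cdot m},$$ where $R$ is the Ricci scalar of $\mathbf{G}$, $\chi_k$ is the $\chi$-curvature of $\mathbf{G}$, $W^i_{~k}$ is the Weyl curvature of $\mathbf{G}$, $\mathbf{S}$ is the S-curvature of $(\mathbf{G},dV)$, and $|$ denotes the horizontal covariant derivative with respect to $\mathbf{G}$.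
   Context: Let $(x^i,y^i)$ be standard local coordinates on $TM$, $TM_0=TM\setminus\{0\}$; the summation convention is used and $f_{\cdot k}=\partial f/\partial y^k$. Spray: a smooth vector field on $TM_0$ of the local form $\mathbf{G}=y^{i}\frac{\partial}{\partial x^{i}}-2G^{i}\frac{\partial}{\partial y^{i}}$ with $G^i(x,\lambda y)=\lambda^2G^i(x,y)$ for all $\lambda>0$. Put $N^i_j=\partial G^i/\partial y^j$, $\Gamma^i_{jk}=\partial^2G^i/\partial y^j\partial y^k$ (Berwald connection), $\frac{\delta}{\delta x^k}=\frac{\partial}{\partial x^k}-N^l_k\frac{\partial}{\partial y^l}$. The horizontal covariant derivative $|$ with respect to $\mathbf{G}$ is that of the Berwald connection: $f_{|k}=\frac{\delta f}{\delta x^k}$, $A_{k|m}=\frac{\delta A_k}{\delta x^m}-\Gamma^l_{km}A_l$, etc.; $R_{\cdot k|m}$ means $(R_{\cdot k})_{|m}$. Curvatures of $\mathbf{G}$: Riemann curvature $R^{i}_{~k}=2\frac{\partial G^{i}}{\partial x^{k}}-y^{j}\frac{\partial^{2} G^{i}}{\partial x^{j}\partial y^{k}}+2G^{j}\frac{\partial^{2} G^{i}}{\partial y^{j}\partial y^{k}}-\frac{\partial G^{i}}{\partial y^{s}}\frac{\partial G^{s}}{\partial y^{k}}$; Ricci curvature $\mathbf{Ric}_{G}=R^m_{~m}$; Ricci scalar $R=\frac{1}{n-1}\mathbf{Ric}_G$; $T^i_{~k}=R^i_{~k}-(R\delta^i_k-\frac12R_{\cdot k}y^i)$; $\chi_k=-\frac13T^m_{~k\cdot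 m}$; Weyl curvature $W^i_{~k}=R^i_{~k}-(R\delta^i_k-\frac12R_{\cdot k}y^i)+\frac{3\chi_k}{n+1}y^i$. For a volume form $dV=\sigma(x)dx^1\cdots dx^n$ ($\sigma>0$), the S-curvature of $(\mathbf{G},dV)$ is $\mathbf{S}=\frac{\partial G^m}{\partial y^m}-y^m\frac{\partial}{\partial x^m}(\ln\sigma)$; it is known that $\chi_k=\frac12\{\mathbf{S}_{\cdot k|m}y^m-\mathbf{S}_{|k}\}$. The associated projective spray is $\hat{\mathbf{G}}=\mathbf{G}+\frac{2\mathbf{S}}{n+1}\mathbf{Y}$, $\mathbf{Y}=y^i\frac{\partial}{\partial y^i}$, i.e. $\hat G^i=G^i-\frac{\mathbf{S}}{n+1}y^i$. Let $\hat R=\frac1{n-1}\mathbf{Ric}_{\hat G}$ be the Ricci scalar of $\hat{\mathbf{G}}$, and let $\parallel$ denote the horizontal covariant derivative with respect to $\hat{\mathbf{G}}$ (defined as $|$ with $\hat G^i$ in place of $G^i$). The Berwald-Weyl curvature $\mathbf{W}^o=W^o_kdx^k$ of $(\mathbf{G},dV)$ is $W^o_k=\hat R_{\parallel k}-\frac12\hat R_{\cdot k\parallel m}y^m$. *)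

theory Defs
  imports "HOL-Analysis.Analysis"
begin

section \<open>Smooth maps\<close>

text \<open>Only used for open \<open>S\<close>; then \<open>Ck_on k S f\<close> says that \<open>f\<close> is of class \<open>C\<^sup>k\<close> on \<open>S\<close>.\<close>

primrec Ck_on :: "nat \<Rightarrow> 'a::real_normed_vector set \<Rightarrow> ('a \<Rightarrow> 'b::real_normed_vector) \<Rightarrow> bool" where
  "Ck_on 0 S f \<longleftrightarrow> continuous_on S f"
| "Ck_on (Suc k) S f \<longleftrightarrow>
     (\<forall>x\<in>S. f differentiable (at x)) \<and> (\<forall>v. Ck_on k S (\<lambda>x. frechet_derivative f (at x) v))"

definition smooth_on :: "'a::real_normed_vector set \<Rightarrow> ('a \<Rightarrow> 'b::real_normed_vector) \<Rightarrow> bool" where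
  "smooth_on S f \<longleftrightarrow> (\<forall>k. Ck_on k S f)"


section \<open>Smooth manifolds of dimension \<open>n = CARD('n)\<close>\<close>

text \<open>A chart is a pair of its domain and its coordinate map (relevant only on the domain).\<close>

type_synonym ('a, 'n) chart = "'a set \<times> ('a \<Rightarrow> real ^ 'n)"

definition is_chart :: "'a topology \<Rightarrow> ('a, 'n::finite) chart \<Rightarrow> bool" where
  "is_chart M c \<longleftrightarrow> openin M (fst c) \<and> open (snd c ` fst c) \<and>
     homeomorphic_map (subtopology M (fst c)) (top_of_set (snd c ` fst c)) (snd c)"

definition overlap :: "('a, 'n::finite) chart \<Rightarrow> ('a, 'n) chart \<Rightarrow> (real ^ 'n) set" where
  "overlap c d = snd c ` (fst c \<inter> fst d)"

definition transition :: "('a, 'n::finite) chart \<Rightarrow> ('a, 'n) chart \<Rightarrow> real ^ 'n \<Rightarrow> real ^ 'n" where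
  "transition c d = snd d \<circ> inv_into (fst c) (snd c)"

text \<open>The atlas is not required to be maximal; it may be the maximal one.\<close>

definition smooth_manifold :: "'a topology \<Rightarrow> ('a, 'n::finite) chart set \<Rightarrow> bool" where
  "smooth_manifold M A \<longleftrightarrow>
     Hausdorff_space M \<and> second_countable M \<and>
     (\<forall>c\<in>A. is_chart M c) \<and> (\<Union>c\<in>A. fst c) = topspace M \<and>
     (\<forall>c\<in>A. \<forall>d\<in>A. smooth_on (overlap c d) (transition c d))"


section \<open>Sprays and volume forms\<close>

text \<open>Every chart \<open>c\<close> of \<open>M\<close> induces the chart \<open>(x, y)\<close> of \<open>TM\<close>; the following is the change of
  coordinates on \<open>TM\<close>. A vector field on \<open>TM\<^sub>0\<close> is given by its component functions in all
  these charts, which on overlaps are related by the derivative of the change of coordinates.\<close>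

definition tangent_transition ::
    "('a, 'n::finite) chart \<Rightarrow> ('a, 'n) chart \<Rightarrow> (real ^ 'n) \<times> (real ^ 'n) \<Rightarrow> (real ^ 'n) \<times> (real ^ 'n)" where
  "tangent_transition c d =
     (\<lambda>(x, y). (transition c d x, frechet_derivative (transition c d) (at x) y))"

definition smooth_vector_field_TM0 ::
    "('a, 'n::finite) chart set \<Rightarrow>
     (('a, 'n) chart \<Rightarrow> (real ^ 'n) \<times> (real ^ 'n) \<Rightarrow> (real ^ 'n) \<times> (real ^ 'n)) \<Rightarrow> bool" where
  "smooth_vector_field_TM0 A X \<longleftrightarrow>
     (\<forall>c\<in>A. smooth_on ((snd c ` fst c) \<times> (- {0})) (X c)) \<and>
     (\<forall>c\<in>A. \<forall>d\<in>A. \<forall>x\<in>overlap c d. \<forall>y. y \<noteq> 0 \<longrightarrow>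
        X d (tangent_transition c d (x, y)) =
          frechet_derivative (tangent_transition c d) (at (x, y)) (X c (x, y)))"

text \<open>\<open>G c x y $ i\<close> is the spray coefficient \<open>G\<^sup>i(x, y)\<close> in the chart \<open>c\<close>; the spray itself is the
  vector field \<open>y\<^sup>i \<partial>/\<partial>x\<^sup>i - 2 G\<^sup>i \<partial>/\<partial>y\<^sup>i\<close>.\<close>

definition is_spray ::
    "('a, 'n::finite) chart set \<Rightarrow> (('a, 'n) chart \<Rightarrow> real ^ 'n \<Rightarrow> real ^ 'n \<Rightarrow> real ^ 'n) \<Rightarrow> bool" where
  "is_spray A G \<longleftrightarrow>
     smooth_vector_field_TM0 A (\<lambda>c (x, y). (y, - 2 *\<^sub>R G c x y)) \<and>
     (\<forall>c\<in>A. \<forall>x\<in>snd c ` fst c. \<forall>y. y \<noteq> 0 \<longrightarrow>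
        (\<forall>l>0. G c x (l *\<^sub>R y) = l\<^sup>2 *\<^sub>R G c x y))"

text \<open>\<open>\<sigma> c\<close> is the density of \<open>dV\<close> in the chart \<open>c\<close>. The absolute value means that no orientation
  is needed; for an oriented atlas this is the transformation law of an \<open>n\<close>-form.\<close>

definition is_volume_form ::
    "('a, 'n::finite) chart set \<Rightarrow> (('a, 'n) chart \<Rightarrow> real ^ 'n \<Rightarrow> real) \<Rightarrow> bool" where
  "is_volume_form A \<sigma> \<longleftrightarrow>
     (\<forall>c\<in>A. smooth_on (snd c ` fst c) (\<sigma> c) \<and> (\<forall>x\<in>snd c ` fst c. \<sigma> c x > 0)) \<and>
     (\<forall>c\<in>A. \<forall>d\<in>A. \<forall>x\<in>overlap c d.
        \<sigma> c x = \<bar>det (jacobian (transition c d) (at x))\<bar> * \<sigma> d (transition c d x))"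


section \<open>Local tensor calculus of a spray\<close>

text \<open>From here on \<open>G\<close> and \<open>\<sigma>\<close> are the data in one fixed chart. Functions of \<open>(x, y)\<close> are curried;
  an upper index comes before a lower one.\<close>

type_synonym 'n tfun = "real ^ 'n \<Rightarrow> real ^ 'n \<Rightarrow> real"
type_synonym 'n coeffs = "real ^ 'n \<Rightarrow> real ^ 'n \<Rightarrow> real ^ 'n"

definition pdx :: "'n::finite \<Rightarrow> 'n tfun \<Rightarrow> 'n tfun" where
  "pdx k f = (\<lambda>x y. deriv (\<lambda>t. f (x + t *\<^sub>R axis k 1) y) 0)"

definition pdy :: "'n::finite \<Rightarrow> 'n tfun \<Rightarrow> 'n tfun" where
  "pdy k f = (\<lambda>x y. deriv (\<lambda>t. f x (y + t *\<^sub>R axis k 1)) 0)"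

definition sprayc :: "'n::finite coeffs \<Rightarrow> 'n \<Rightarrow> 'n tfun" where
  "sprayc G i = (\<lambda>x y. G x y $ i)"

definition Nconn :: "'n::finite coeffs \<Rightarrow> 'n \<Rightarrow> 'n \<Rightarrow> 'n tfun" where
  "Nconn G i j = pdy j (sprayc G i)"

definition Berwald :: "'n::finite coeffs \<Rightarrow> 'n \<Rightarrow> 'n \<Rightarrow> 'n \<Rightarrow> 'n tfun" where
  "Berwald G i j k = pdy j (pdy k (sprayc G i))"

definition hdelta :: "'n::finite coeffs \<Rightarrow> 'n \<Rightarrow> 'n tfun \<Rightarrow> 'n tfun" where
  "hdelta G k f = (\<lambda>x y. pdx k f x y - (\<Sum>l\<in>UNIV. Nconn G l k x y * pdy l f x y))"

text \<open>\<open>hcov0 G f k\<close> is \<open>f\<^sub>|\<^sub>k\<close> for a function \<open>f\<close>; \<open>hcov1 G A k m\<close> is \<open>A\<^sub>k\<^sub>|\<^sub>m\<close> for a covector \<open>A\<close>.\<close>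

definition hcov0 :: "'n::finite coeffs \<Rightarrow> 'n tfun \<Rightarrow> 'n \<Rightarrow> 'n tfun" where
  "hcov0 G f k = hdelta G k f"

definition hcov1 :: "'n::finite coeffs \<Rightarrow> ('n \<Rightarrow> 'n tfun) \<Rightarrow> 'n \<Rightarrow> 'n \<Rightarrow> 'n tfun" where
  "hcov1 G A k m = (\<lambda>x y. hdelta G m (A k) x y - (\<Sum>l\<in>UNIV. Berwald G l k m x y * A l x y))"


section \<open>Curvatures\<close>

definition Riem :: "'n::finite coeffs \<Rightarrow> 'n \<Rightarrow> 'n \<Rightarrow> 'n tfun" where
  "Riem G i k = (\<lambda>x y.
     2 * pdx k (sprayc G i) x y
     - (\<Sum>j\<in>UNIV. y $ j * pdx j (pdy k (sprayc G i)) x y)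
     + 2 * (\<Sum>j\<in>UNIV. sprayc G j x y * pdy j (pdy k (sprayc G i)) x y)
     - (\<Sum>s\<in>UNIV. pdy s (sprayc G i) x y * pdy k (sprayc G s) x y))"

definition Ricci :: "'n::finite coeffs \<Rightarrow> 'n tfun" where
  "Ricci G = (\<lambda>x y. \<Sum>m\<in>UNIV. Riem G m m x y)"

definition Ricci_scalar :: "'n::finite coeffs \<Rightarrow> 'n tfun" where
  "Ricci_scalar G = (\<lambda>x y. Ricci G x y / (real CARD('n) - 1))"

definition Tcurv :: "'n::finite coeffs \<Rightarrow> 'n \<Rightarrow> 'n \<Rightarrow> 'n tfun" where
  "Tcurv G i k = (\<lambda>x y. Riem G i k x y
     - (Ricci_scalar G x y * (if i = k then 1 else 0) - 1/2 * pdy k (Ricci_scalar G) x y * y $ i))"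

definition chi_curv :: "'n::finite coeffs \<Rightarrow> 'n \<Rightarrow> 'n tfun" where
  "chi_curv G k = (\<lambda>x y. - (1/3) * (\<Sum>m\<in>UNIV. pdy m (Tcurv G m k) x y))"

definition Weyl_curv :: "'n::finite coeffs \<Rightarrow> 'n \<Rightarrow> 'n \<Rightarrow> 'n tfun" where
  "Weyl_curv G i k = (\<lambda>x y. Riem G i k x y
     - (Ricci_scalar G x y * (if i = k then 1 else 0) - 1/2 * pdy k (Ricci_scalar G) x y * y $ i)
     + 3 * chi_curv G k x y / (real CARD('n) + 1) * y $ i)"

definition S_curv :: "'n::finite coeffs \<Rightarrow> (real ^ 'n \<Rightarrow> real) \<Rightarrow> 'n tfun" where
  "S_curv G \<sigma> = (\<lambda>x y. (\<Sum>m\<in>UNIV. pdy m (sprayc G m) x y)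
     - (\<Sum>m\<in>UNIV. y $ m * pdx m (\<lambda>x y. ln (\<sigma> x)) x y))"

definition projective_spray :: "'n::finite coeffs \<Rightarrow> (real ^ 'n \<Rightarrow> real) \<Rightarrow> 'n coeffs" where
  "projective_spray G \<sigma> = (\<lambda>x y. G x y - (S_curv G \<sigma> x y / (real CARD('n) + 1)) *\<^sub>R y)"

definition Berwald_Weyl :: "'n::finite coeffs \<Rightarrow> (real ^ 'n \<Rightarrow> real) \<Rightarrow> 'n \<Rightarrow> 'n tfun" where
  "Berwald_Weyl G \<sigma> k = (\<lambda>x y.
     let G' = projective_spray G \<sigma>; R' = Ricci_scalar G' in
     hcov0 G' R' k x y - 1/2 * (\<Sum>m\<in>UNIV. hcov1 G' (\<lambda>j. pdy j R') k m x y * y $ m))"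

end

theory Submission
  imports Defs
begin

text \<open>The statement is an identity between functions of \<open>(x, y)\<close> in one chart. Instead of expanding
  all indices, the proof works with the derivation \<open>\<G> f = y\<^sup>m \<partial>f/\<partial>x\<^sup>m - 2 G\<^sup>l \<partial>f/\<partial>y\<^sup>l\<close>, the spray acting on
  functions (\<open>spray_deriv\<close>), and with its extension to covectors \<open>(D A)\<^sub>k = \<G> A\<^sub>k - N\<^sup>l\<^sub>k A\<^sub>l\<close>
  (\<open>cov_deriv\<close>). Euler's identity for \<open>G\<^sup>i\<close> gives \<open>A\<^sub>k\<^sub>|\<^sub>m y\<^sup>m = (D A)\<^sub>k\<close> (\<open>hcov1_fibre\<close>), so only \<open>\<G>\<close>, \<open>D\<close>
  and \<open>\<delta>/\<delta>x\<^sup>k\<close> are left, and these obey two commutation rules: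
  \<open>(\<G> f)\<^sub>\<cdot>\<^sub>k = (D f\<^sub>\<cdot>)\<^sub>k + f\<^sub>|\<^sub>k\<close> (\<open>pdy_spray_deriv_cov\<close>) and
  \<open>(D f\<^sub>|)\<^sub>k = (\<G> f)\<^sub>|\<^sub>k + R\<^sup>m\<^sub>k f\<^sub>\<cdot>\<^sub>m\<close> (\<open>cov_deriv_hdelta\<close>). The second one is the way in which the Riemann
  curvature enters.

  Put \<open>P = - S / (n + 1)\<close>, so that the projective spray has the coefficients \<open>G\<^sup>i + P y\<^sup>i\<close>, and
  \<open>B(f)\<^sub>k = f\<^sub>|\<^sub>k - 1/2 (D f\<^sub>\<cdot>)\<^sub>k\<close>. The Berwald-Weyl curvature is \<open>B\<close> of the projective spray, applied to
  the Ricci scalar of the projective spray. Four facts determine it: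
  \<^item> that Ricci scalar is \<open>R + \<Xi>\<close> with \<open>\<Xi> = P\<^sup>2 - \<G> P\<close> (\<open>Ricci_proj_change\<close>);
  \<^item> on functions of degree two the change of spray turns \<open>B(f)\<^sub>k\<close> into
    \<open>B(f)\<^sub>k + 1/2 P f\<^sub>\<cdot>\<^sub>k - P\<^sub>\<cdot>\<^sub>k f\<close> (\<open>Berwald_Weyl_operator_proj_change\<close>);
  \<^item> the commutation rules give \<open>B(\<Xi>)\<close>, with \<open>R\<^sup>m\<^sub>k P\<^sub>\<cdot>\<^sub>m\<close> as its curvature term
    (\<open>Berwald_Weyl_operator_riccati\<close>);
  \<^item> \<open>\<chi>\<^sub>k = 1/2 ((D S\<^sub>\<cdot>)\<^sub>k - S\<^sub>|\<^sub>k)\<close> (\<open>chi_curv_S_curv\<close>).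

  In the sum the terms cubic in \<open>P\<close> and those with \<open>P\<^sub>\<cdot>\<^sub>k \<G> P\<close> cancel, and there remains
  \<open>B(R)\<^sub>k - 1/(n + 1) (D \<chi>)\<^sub>k + R\<^sup>m\<^sub>k P\<^sub>\<cdot>\<^sub>m + 3/(n + 1) \<chi>\<^sub>k P + 1/2 R\<^sub>\<cdot>\<^sub>k P - R P\<^sub>\<cdot>\<^sub>k\<close>. Because \<open>P = y\<^sup>m P\<^sub>\<cdot>\<^sub>m\<close>, the
  last four terms are \<open>W\<^sup>m\<^sub>k P\<^sub>\<cdot>\<^sub>m\<close>, which is the claim.\<close>

section \<open>Functions of class \<open>C\<^sup>k\<close>\<close>

lemma frechet_derivative_cong:
  assumes "open S" "p \<in> S" "\<And>q. q \<in> S \<Longrightarrow> f q = g q"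
  shows "frechet_derivative f (at p) = frechet_derivative g (at p)"
proof -
  have "(f has_derivative D) (at p) = (g has_derivative D) (at p)" for D
    using assms has_derivative_transform_within_open[OF _ assms(1,2)] by metis
  then show ?thesis unfolding frechet_derivative_def by simp
qed

lemma Ck_on_cong:
  assumes "open S" "\<And>x. x \<in> S \<Longrightarrow> f x = g x"
  shows "Ck_on k S f = Ck_on k S g"
  using assms(2)
proof (induction k arbitrary: f g)
  case 0
  then show ?case by (auto intro: continuous_on_cong)
next
  case (Suc k)
  have *: "(f has_derivative D) (at x) = (g has_derivative D) (at x)" if "x \<in> S" for x D
    using Suc.prems that has_derivative_transform_within_open[OF _ assms(1) that] by metis
  have "Ck_on k S (\<lambda>x. frechet_derivative f (at x) v) = Ck_on k S (\<lambda>x. frechet_derivative g (at x) v)" for v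
    by (rule Suc.IH) (simp add: frechet_derivative_cong[OF assms(1) _ Suc.prems])
  with * show ?case by (auto simp: differentiable_def)
qed

text \<open>In \<open>Ck_on\<close> the derivative is the total function \<open>frechet_derivative\<close>, which is a concrete
  expression only on \<open>S\<close>. Invariance under changes outside the open set \<open>S\<close> lets explicit
  derivatives be used in the closure proofs below.\<close>

lemma Ck_onI:
  assumes "\<And>x. x \<in> S \<Longrightarrow> (f has_derivative f' x) (at x)"
    and "\<And>v. Ck_on k S (\<lambda>x. f' x v)" and "open S"
  shows "Ck_on (Suc k) S f"
proof -
  have "frechet_derivative f (at x) = f' x" if "x \<in> S" for x
    using frechet_derivative_at[OF assms(1)[OF that]] by simp
  then have "Ck_on k S (\<lambda>x. frechet_derivative f (at x) v)" for v
    using assms(2)[of v] Ck_on_cong[OF assms(3), of "\<lambda>x. frechet_derivative f (at x) v" "\<lambda>x. f' x v"] by simp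
  with assms(1) show ?thesis
    by (auto simp: differentiable_def)
qed

lemma Ck_on_Suc_imp: "Ck_on (Suc k) S f \<Longrightarrow> Ck_on k S f"
proof (induction k arbitrary: f)
  case 0
  then show ?case
    by (auto intro!: continuous_at_imp_continuous_on differentiable_imp_continuous_within)
next
  case (Suc k)
  then show ?case by (metis Ck_on.simps(2))
qed

lemma Ck_on_has_derivative:
  "Ck_on (Suc k) S f \<Longrightarrow> x \<in> S \<Longrightarrow> (f has_derivative frechet_derivative f (at x)) (at x)"
  by (simp add: frechet_derivative_works)

lemma Ck_on_frechet_derivative:
  "Ck_on (Suc k) S f \<Longrightarrow> Ck_on k S (\<lambda>x. frechet_derivative f (at x) v)"
  by simp

lemma Ck_on_const: "Ck_on k S (\<lambda>x. c)"
  by (induction k arbitrary: c) (auto simp: frechet_derivative_const)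

lemma Ck_on_add:
  assumes "open S" "Ck_on k S f" "Ck_on k S g"
  shows "Ck_on k S (\<lambda>x. f x + g x)"
  using assms(2,3)
proof (induction k arbitrary: f g)
  case 0
  then show ?case by (auto intro: continuous_on_add)
next
  case (Suc k)
  show ?case
    by (rule Ck_onI[OF has_derivative_add[OF Ck_on_has_derivative[OF Suc.prems(1)] Ck_on_has_derivative[OF Suc.prems(2)]]])
      (assumption | intro Suc.IH Ck_on_frechet_derivative Suc.prems assms)+
qed

lemma Ck_on_bilinear:
  assumes "bounded_bilinear \<beta>" "open S" "Ck_on k S f" "Ck_on k S g"
  shows "Ck_on k S (\<lambda>x. \<beta> (f x) (g x))"
  using assms(3,4)
proof (induction k arbitrary: f g)
  case 0
  then show ?case by (auto intro: bounded_bilinear.continuous_on[OF assms(1)])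
next
  case (Suc k)
  show ?case
    by (rule Ck_onI[OF bounded_bilinear.FDERIV[OF assms(1) Ck_on_has_derivative[OF Suc.prems(1)] Ck_on_has_derivative[OF Suc.prems(2)]]])
      (assumption | intro Ck_on_add Suc.IH Ck_on_frechet_derivative Ck_on_Suc_imp[OF Suc.prems(1)]
        Ck_on_Suc_imp[OF Suc.prems(2)] Suc.prems assms)+
qed

lemma Ck_on_bounded_linear_comp:
  assumes "bounded_linear L" "open S" "Ck_on k S f"
  shows "Ck_on k S (\<lambda>x. L (f x))"
  using assms(3)
proof (induction k arbitrary: f)
  case 0
  then show ?case by (auto intro: bounded_linear.continuous_on[OF assms(1)])
next
  case (Suc k)
  show ?case
    by (rule Ck_onI[OF bounded_linear.has_derivative[OF assms(1) Ck_on_has_derivative[OF Suc.prems]]])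
      (assumption | intro Suc.IH Ck_on_frechet_derivative Suc.prems assms)+
qed

lemma Ck_on_comp_bounded_linear:
  assumes "bounded_linear L" "open S" "L ` S \<subseteq> T" "Ck_on k T f"
  shows "Ck_on k S (\<lambda>x. f (L x))"
  using assms(4)
proof (induction k arbitrary: f)
  case 0
  then show ?case
    using assms(3) by (auto intro!: continuous_on_compose2[of T f] linear_continuous_on[OF assms(1)])
next
  case (Suc k)
  show ?case
    by (rule Ck_onI[OF has_derivative_compose[OF bounded_linear_imp_has_derivative[OF assms(1)] Ck_on_has_derivative[OF Suc.prems]]])
      (use assms(3) in blast, rule Suc.IH, intro Ck_on_frechet_derivative Suc.prems, rule assms)
qed

lemma Ck_on_bounded_linear:
  assumes "bounded_linear L"  "open S"
  shows "Ck_on k S L"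
proof (cases k)
  case 0
  then show ?thesis by (auto intro: linear_continuous_on assms)
next
  case (Suc k)
  show ?thesis unfolding Suc
    by (rule Ck_onI[OF bounded_linear_imp_has_derivative[OF assms(1)] Ck_on_const assms(2)])
qed

lemma Ck_on_inverse:
  fixes f :: "'a::real_normed_vector \<Rightarrow> real"
  assumes "open S" "\<And>x. x \<in> S \<Longrightarrow> f x \<noteq> 0" "Ck_on k S f"
  shows "Ck_on k S (\<lambda>x. inverse (f x))"
  using assms(3)
proof (induction k)
  case 0
  then show ?case using assms by (auto intro: continuous_on_inverse)
next
  case (Suc k)
  show ?case
    by (rule Ck_onI[OF Deriv.has_derivative_inverse[OF assms(2) Ck_on_has_derivative[OF Suc.prems]]])
      (intro assms Ck_on_bilinear[OF bounded_bilinear_mult] Suc.IH Ck_on_frechet_derivative Suc.prems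
         Ck_on_bounded_linear_comp[OF bounded_linear_minus[OF bounded_linear_ident]] Ck_on_Suc_imp[OF Suc.prems] | assumption)+
qed

lemma Ck_on_ln:
  fixes f :: "'a::real_normed_vector \<Rightarrow> real"
  assumes "open S" "\<And>x. x \<in> S \<Longrightarrow> f x > 0" "Ck_on k S f"
  shows "Ck_on k S (\<lambda>x. ln (f x))"
proof (cases k)
  case 0
  then show ?thesis using assms by (force intro!: continuous_on_ln)
next
  case (Suc k)
  note f = assms(3)[unfolded Suc]
  show ?thesis unfolding Suc
  proof (rule Ck_onI[OF _ _ assms(1)])
    show "((\<lambda>x. ln (f x)) has_derivative (\<lambda>v. inverse (f x) * frechet_derivative f (at x) v)) (at x)"
      if "x \<in> S" for x
      using has_derivative_ln[OF assms(2)[OF that] Ck_on_has_derivative[OF f that]]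
      by (simp add: mult.commute)
    show "Ck_on k S (\<lambda>x. inverse (f x) * frechet_derivative f (at x) v)" for v
      by (intro Ck_on_bilinear[OF bounded_bilinear_mult] Ck_on_inverse assms(1)
          Ck_on_frechet_derivative f Ck_on_Suc_imp[OF f]) (use assms(2) in force)
  qed
qed

lemma smooth_onI: "(\<And>k. Ck_on k S f) \<Longrightarrow> smooth_on S f"
  by (simp add: smooth_on_def)

lemma smooth_onD: "smooth_on S f \<Longrightarrow> Ck_on k S f"
  by (simp add: smooth_on_def)

lemma smooth_on_frechet_derivative:
  "smooth_on S f \<Longrightarrow> smooth_on S (\<lambda>x. frechet_derivative f (at x) v)"
  by (rule smooth_onI, rule Ck_on_frechet_derivative, erule smooth_onD)

section \<open>Symmetry of second derivatives\<close>

text \<open>The second difference of \<open>f\<close> over a parallelogram is a mixed derivative at an interior point: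
  the mean value theorem is applied first along \<open>u\<close>, to the difference of two opposite sides,
  then along \<open>v\<close>.\<close>

lemma mixed_difference_mean_value:
  fixes f :: "'a::real_normed_vector \<Rightarrow> real"
  assumes f: "\<And>q. q \<in> B \<Longrightarrow> (f has_derivative f' q) (at q)"
    and fu: "\<And>q. q \<in> B \<Longrightarrow> ((\<lambda>q. f' q u) has_derivative f'' q) (at q)"
    and B: "\<And>s t. \<lbrakk>0 \<le> s; s \<le> h; 0 \<le> t; t \<le> h\<rbrakk> \<Longrightarrow> p + s *\<^sub>R u + t *\<^sub>R v \<in> B"
    and "h > 0"
  shows "\<exists>s t. 0 < s \<and> s < h \<and> 0 < t \<and> t < h \<and>
    f (p + h *\<^sub>R u + h *\<^sub>R v) - f (p + h *\<^sub>R u) - f (p + h *\<^sub>R v) + f p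
     = h\<^sup>2 * f'' (p + s *\<^sub>R u + t *\<^sub>R v) v"
proof -
  have ds: "((\<lambda>s. f (p + s *\<^sub>R u + t *\<^sub>R v)) has_real_derivative f' (p + s *\<^sub>R u + t *\<^sub>R v) u) (at s)"
    if "0 \<le> s" "s \<le> h" "0 \<le> t" "t \<le> h" for s t
  proof -
    have "((\<lambda>s. p + s *\<^sub>R u + t *\<^sub>R v) has_derivative (\<lambda>r. r *\<^sub>R u)) (at s)"
      by (auto intro!: derivative_eq_intros)
    from has_derivative_compose[OF this f[OF B[OF that]]]
    show ?thesis unfolding has_field_derivative_def
      by (rule has_derivative_eq_rhs)
        (use has_derivative_linear[OF f[OF B[OF that]]] in \<open>auto simp: linear_cmul mult.commute\<close>)
  qed
  have dt: "((\<lambda>t. f' (p + s *\<^sub>R u + t *\<^sub>R v) u) has_real_derivative f'' (p + s *\<^sub>R u + t *\<^sub>R v) v) (at t)"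
    if "0 \<le> s" "s \<le> h" "0 \<le> t" "t \<le> h" for s t
  proof -
    have "((\<lambda>t. p + s *\<^sub>R u + t *\<^sub>R v) has_derivative (\<lambda>r. r *\<^sub>R v)) (at t)"
      by (auto intro!: derivative_eq_intros)
    from has_derivative_compose[OF this fu[OF B[OF that]]]
    show ?thesis unfolding has_field_derivative_def
      by (rule has_derivative_eq_rhs)
        (use has_derivative_linear[OF fu[OF B[OF that]]] in \<open>auto simp: linear_cmul mult.commute\<close>)
  qed
  define \<phi> where "\<phi> s = f (p + s *\<^sub>R u + h *\<^sub>R v) - f (p + s *\<^sub>R u + 0 *\<^sub>R v)" for s
  have "(\<phi> has_real_derivative
      f' (p + s *\<^sub>R u + h *\<^sub>R v) u - f' (p + s *\<^sub>R u + 0 *\<^sub>R v) u) (at s)"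
    if "0 \<le> s" "s \<le> h" for s
    unfolding \<phi>_def using \<open>h > 0\<close> by (intro DERIV_diff ds that) auto
  from MVT2[OF \<open>h > 0\<close> this] obtain s where s: "0 < s" "s < h"
    and 1: "\<phi> h - \<phi> 0 = h * (f' (p + s *\<^sub>R u + h *\<^sub>R v) u - f' (p + s *\<^sub>R u + 0 *\<^sub>R v) u)"
    by auto
  from MVT2[OF \<open>h > 0\<close> dt[of s]] s obtain t where t: "0 < t" "t < h"
    and 2: "f' (p + s *\<^sub>R u + h *\<^sub>R v) u - f' (p + s *\<^sub>R u + 0 *\<^sub>R v) u = h * f'' (p + s *\<^sub>R u + t *\<^sub>R v) v"
    by auto
  show ?thesis
    using s t 1 unfolding 2 \<phi>_def by (intro exI[of _ s] exI[of _ t]) (simp add: power2_eq_square)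
qed

text \<open>The second difference is symmetric in \<open>u\<close> and \<open>v\<close>, so the two mixed derivatives take equal
  values at points (in general different ones) arbitrarily close to \<open>p\<close>, where both are continuous.\<close>

lemma mixed_derivatives_commute:
  fixes f :: "'a::real_normed_vector \<Rightarrow> real"
  assumes "open S" "Ck_on 2 S f" "p \<in> S"
  defines "D \<equiv> \<lambda>u g q. frechet_derivative g (at q) u"
  shows "D v (D u f) p = D u (D v f) p"
proof (rule ccontr)
  assume neq: "D v (D u f) p \<noteq> D u (D v f) p"
  define e where "e = \<bar>D v (D u f) p - D u (D v f) p\<bar> / 2"
  have "e > 0" using neq by (simp add: e_def)
  have C2: "Ck_on (Suc (Suc 0)) S f" using assms(2) by (simp add: numeral_2_eq_2)
  have f: "(f has_derivative (\<lambda>u. D u f q)) (at q)" if "q \<in> S" for q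
    using Ck_on_has_derivative[OF C2 that] by (simp add: D_def)
  have Df: "(D w f has_derivative (\<lambda>u. D u (D w f) q)) (at q)" if "q \<in> S" for q w
    using C2 that by (auto simp: D_def frechet_derivative_works)
  have cont: "isCont (D u (D w f)) q" if "q \<in> S" for q u w
    using C2 that assms(1) by (auto simp: D_def continuous_on_eq_continuous_at)
  obtain d1 where d1: "d1 > 0" "\<And>q. dist q p < d1 \<Longrightarrow> dist (D v (D u f) q) (D v (D u f) p) < e"
    using cont[OF assms(3), of v u, unfolded continuous_at_eps_delta, rule_format, OF \<open>e > 0\<close>] by blast
  obtain d2 where d2: "d2 > 0" "\<And>q. dist q p < d2 \<Longrightarrow> dist (D u (D v f) q) (D u (D v f) p) < e"
    using cont[OF assms(3), of u v, unfolded continuous_at_eps_delta, rule_format, OF \<open>e > 0\<close>] by blast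
  obtain d3 where d3: "d3 > 0" "ball p d3 \<subseteq> S"
    using assms(1,3) open_contains_ball by blast
  define d where "d = min d1 (min d2 d3)"
  have d: "d > 0" "d \<le> d1" "d \<le> d2" "d \<le> d3" using d1 d2 d3 by (auto simp: d_def)
  \<comment> \<open>small enough for the parallelogram to stay in the ball of radius \<open>d\<close>, also if \<open>u\<close> or \<open>v\<close> is zero\<close>
  define h where "h = d / (norm u + norm v + 1)"
  have "h > 0" using d(1) by (auto simp: h_def intro!: divide_pos_pos add_nonneg_pos)
  have hd: "h * (norm u + norm v + 1) = d"
    using add_nonneg_pos[of "norm u + norm v" 1] unfolding h_def by simp
  have near: "dist (p + s *\<^sub>R u + t *\<^sub>R v) p < d" "dist (p + s *\<^sub>R v + t *\<^sub>R u) p < d"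
    if "0 \<le> s" "s \<le> h" "0 \<le> t" "t \<le> h" for s t
  proof -
    have 1: "norm (a *\<^sub>R u + b *\<^sub>R v) < d" if "0 \<le> a" "a \<le> h" "0 \<le> b" "b \<le> h" for a b
    proof -
      have "norm (a *\<^sub>R u + b *\<^sub>R v) \<le> a * norm u + b * norm v"
        using norm_triangle_ineq[of "a *\<^sub>R u" "b *\<^sub>R v"] that by simp
      also have "\<dots> \<le> h * norm u + h * norm v"
        using that by (intro add_mono mult_right_mono) auto
      also have "\<dots> < d" using \<open>h > 0\<close> hd by (simp add: algebra_simps)
      finally show ?thesis .
    qed
    show "dist (p + s *\<^sub>R u + t *\<^sub>R v) p < d" "dist (p + s *\<^sub>R v + t *\<^sub>R u) p < d"
      using 1[of s t] 1[of t s] that by (simp_all add: dist_norm add.assoc add.commute[of "t *\<^sub>R u"])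
  qed
  have inS: "q \<in> S" if "dist q p < d" for q
    using that d d3 by (auto simp: dist_commute)
  define \<Delta> where "\<Delta> = f (p + h *\<^sub>R u + h *\<^sub>R v) - f (p + h *\<^sub>R u) - f (p + h *\<^sub>R v) + f p"
  obtain s t where st: "0 < s" "s < h" "0 < t" "t < h"
    and \<Delta>1: "\<Delta> = h\<^sup>2 * D v (D u f) (p + s *\<^sub>R u + t *\<^sub>R v)"
    using mixed_difference_mean_value[of S f "\<lambda>q u. D u f q" u "\<lambda>q w. D w (D u f) q" h p v,
        OF f Df inS[OF near(1)] \<open>h > 0\<close>] unfolding \<Delta>_def by blast
  obtain s' t' where st': "0 < s'" "s' < h" "0 < t'" "t' < h"
    and \<Delta>2: "f (p + h *\<^sub>R v + h *\<^sub>R u) - f (p + h *\<^sub>R v) - f (p + h *\<^sub>R u) + f p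
      = h\<^sup>2 * D u (D v f) (p + s' *\<^sub>R v + t' *\<^sub>R u)"
    using mixed_difference_mean_value[of S f "\<lambda>q u. D u f q" v "\<lambda>q w. D w (D v f) q" h p u,
        OF f Df inS[OF near(2)] \<open>h > 0\<close>] by blast
  define q1 q2 where "q1 = p + s *\<^sub>R u + t *\<^sub>R v" and "q2 = p + s' *\<^sub>R v + t' *\<^sub>R u"
  have "p + h *\<^sub>R v + h *\<^sub>R u = p + h *\<^sub>R u + h *\<^sub>R v" by simp
  with \<Delta>2 have "\<Delta> = h\<^sup>2 * D u (D v f) q2" unfolding \<Delta>_def q2_def by simp
  with \<Delta>1 have q: "h\<^sup>2 * D v (D u f) q1 = h\<^sup>2 * D u (D v f) q2" unfolding q1_def by metis
  have q1: "dist q1 p < d" and q2: "dist q2 p < d"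
    using near(1)[of s t] near(2)[of s' t'] st st' unfolding q1_def q2_def by auto
  have "D v (D u f) q1 = D u (D v f) q2"
    using q \<open>h > 0\<close> by simp
  moreover have "\<bar>D v (D u f) q1 - D v (D u f) p\<bar> < e" "\<bar>D u (D v f) q2 - D u (D v f) p\<bar> < e"
    using d1(2)[of q1] d2(2)[of q2] q1 q2 d by (auto simp: dist_real_def)
  ultimately have "\<bar>D v (D u f) p - D u (D v f) p\<bar> < 2 * e" by linarith
  then show False by (simp add: e_def)
qed

section \<open>Partial derivatives on the slit tangent bundle of a coordinate domain\<close>

definition smooth_tfun :: "(real ^ 'n::finite) set \<Rightarrow> 'n tfun \<Rightarrow> bool" where
  "smooth_tfun U f \<longleftrightarrow> smooth_on (U \<times> - {0}) (\<lambda>(x, y). f x y)"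

text \<open>The zero section is removed, as a spray is smooth only off it. Hence all rules below are
  conditional on \<open>x \<in> U\<close> and \<open>y \<noteq> 0\<close>.\<close>

locale punctured_tangent =
  fixes U :: "(real ^ 'n::finite) set"
  assumes open_base: "open U"
begin

abbreviation smooth :: "'n tfun \<Rightarrow> bool" where
  "smooth \<equiv> smooth_tfun U"

lemma open_domain: "open (U \<times> - {0 :: real ^ 'n})"
  by (intro open_Times open_base open_Compl closed_singleton)

lemma smooth_cong:
  assumes "\<And>x y. \<lbrakk>x \<in> U; y \<noteq> 0\<rbrakk> \<Longrightarrow> f x y = g x y"
  shows "smooth f = smooth g"
  unfolding smooth_tfun_def smooth_on_def
  by (rule all_cong1, rule Ck_on_cong[OF open_domain]) (use assms in auto)

lemma smooth_const [simp]: "smooth (\<lambda>x y. a)"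
  unfolding smooth_tfun_def split_def by (intro smooth_onI Ck_on_const)

lemma smooth_add [simp]: "\<lbrakk>smooth f; smooth g\<rbrakk> \<Longrightarrow> smooth (\<lambda>x y. f x y + g x y)"
  unfolding smooth_tfun_def split_def
  by (intro smooth_onI Ck_on_add[OF open_domain]; erule smooth_onD)

lemma smooth_mult [simp]: "\<lbrakk>smooth f; smooth g\<rbrakk> \<Longrightarrow> smooth (\<lambda>x y. f x y * g x y)"
  unfolding smooth_tfun_def split_def
  by (intro smooth_onI Ck_on_bilinear[OF bounded_bilinear_mult open_domain]; erule smooth_onD)

lemma smooth_diff [simp]: "\<lbrakk>smooth f; smooth g\<rbrakk> \<Longrightarrow> smooth (\<lambda>x y. f x y - g x y)"
  using smooth_add[of f "\<lambda>x y. -1 * g x y"] smooth_mult[of "\<lambda>x y. -1" g] by simp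

lemma smooth_divide [simp]: "smooth f \<Longrightarrow> smooth (\<lambda>x y. f x y / a)"
  using smooth_mult[of f "\<lambda>x y. inverse a"] by (simp add: divide_inverse)

lemma smooth_sum [simp]: "(\<And>i. smooth (f i)) \<Longrightarrow> smooth (\<lambda>x y. \<Sum>i\<in>I. f i x y)"
  by (induction I rule: infinite_finite_induct) simp_all

lemma smooth_fibre_coord [simp]: "smooth (\<lambda>x y. y $ i)"
  unfolding smooth_tfun_def split_def
  by (intro smooth_onI Ck_on_bounded_linear open_domain
      bounded_linear_compose[OF bounded_linear_vec_nth bounded_linear_snd])

lemma smooth_base:
  assumes "smooth_on U s" shows "smooth (\<lambda>x y. s x)"
  unfolding smooth_tfun_def split_def
  by (intro smooth_onI Ck_on_comp_bounded_linear[OF bounded_linear_fst open_domain, of U] smooth_onD[OF assms]) auto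

lemma has_derivative_uncurried:
  assumes "smooth f" "x \<in> U" "y \<noteq> 0"
  shows "((\<lambda>(x, y). f x y) has_derivative frechet_derivative (\<lambda>(x, y). f x y) (at (x, y))) (at (x, y))"
  using assms Ck_on_has_derivative[of 0 "U \<times> - {0}" "\<lambda>(x, y). f x y" "(x, y)"]
  unfolding smooth_tfun_def smooth_on_def by simp

text \<open>The operators \<open>pdx\<close> and \<open>pdy\<close> differentiate along coordinate lines; for smooth functions they
  are values of the total derivative in \<open>(x, y)\<close>, which makes the results on class \<open>C\<^sup>k\<close> available.\<close>

lemma
  assumes "smooth f" "x \<in> U" "y \<noteq> 0"
  shows DERIV_pdx: "((\<lambda>t. f (x + t *\<^sub>R axis k 1) y) has_field_derivative pdx k f x y) (at 0)"
    and DERIV_pdy: "((\<lambda>t. f x (y + t *\<^sub>R axis k 1)) has_field_derivative pdy k f x y) (at 0)"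
    and pdx_frechet: "pdx k f x y = frechet_derivative (\<lambda>(x, y). f x y) (at (x, y)) (axis k 1, 0)"
    and pdy_frechet: "pdy k f x y = frechet_derivative (\<lambda>(x, y). f x y) (at (x, y)) (0, axis k 1)"
proof -
  have gen: "((\<lambda>t. f (x + t *\<^sub>R u) (y + t *\<^sub>R v)) has_field_derivative
      frechet_derivative (\<lambda>(x, y). f x y) (at (x, y)) (u, v)) (at 0)" for u v
  proof -
    have "((\<lambda>t. (x + t *\<^sub>R u, y + t *\<^sub>R v)) has_derivative (\<lambda>r. (r *\<^sub>R u, r *\<^sub>R v))) (at 0)"
      by (auto intro!: derivative_eq_intros)
    from has_derivative_compose[OF this, of "\<lambda>(x, y). f x y"] has_derivative_uncurried[OF assms]
    have "((\<lambda>t. f (x + t *\<^sub>R u) (y + t *\<^sub>R v)) has_derivative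
      (\<lambda>r. frechet_derivative (\<lambda>(x, y). f x y) (at (x, y)) (r *\<^sub>R u, r *\<^sub>R v))) (at 0)" by simp
    moreover have "frechet_derivative (\<lambda>(x, y). f x y) (at (x, y)) (r *\<^sub>R u, r *\<^sub>R v) =
      frechet_derivative (\<lambda>(x, y). f x y) (at (x, y)) (u, v) * r" for r
      using linear_cmul[OF has_derivative_linear[OF has_derivative_uncurried[OF assms]], of r "(u, v)"]
      unfolding scaleR_Pair real_scaleR_def by (rule trans) (rule mult.commute)
    ultimately show ?thesis unfolding has_field_derivative_def by (simp add: fun_eq_iff)
  qed
  show 1: "pdx k f x y = frechet_derivative (\<lambda>(x, y). f x y) (at (x, y)) (axis k 1, 0)"
    using DERIV_imp_deriv[OF gen[of "axis k 1" 0]] by (simp add: pdx_def)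
  show 2: "pdy k f x y = frechet_derivative (\<lambda>(x, y). f x y) (at (x, y)) (0, axis k 1)"
    using DERIV_imp_deriv[OF gen[of 0 "axis k 1"]] by (simp add: pdy_def)
  show "((\<lambda>t. f (x + t *\<^sub>R axis k 1) y) has_field_derivative pdx k f x y) (at 0)"
    using gen[of "axis k 1" 0] by (simp add: 1)
  show "((\<lambda>t. f x (y + t *\<^sub>R axis k 1)) has_field_derivative pdy k f x y) (at 0)"
    using gen[of 0 "axis k 1"] by (simp add: 2)
qed

lemma smooth_pdx [simp]:
  assumes "smooth f" shows "smooth (pdx k f)"
proof -
  have "smooth (\<lambda>x y. frechet_derivative (\<lambda>(x, y). f x y) (at (x, y)) (axis k 1, 0))"
    using smooth_on_frechet_derivative[OF assms[unfolded smooth_tfun_def]]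
    unfolding smooth_tfun_def split_def by simp
  then show ?thesis
    by (subst smooth_cong[OF pdx_frechet[OF assms]])
qed

lemma smooth_pdy [simp]:
  assumes "smooth f" shows "smooth (pdy k f)"
proof -
  have "smooth (\<lambda>x y. frechet_derivative (\<lambda>(x, y). f x y) (at (x, y)) (0, axis k 1))"
    using smooth_on_frechet_derivative[OF assms[unfolded smooth_tfun_def]]
    unfolding smooth_tfun_def split_def by simp
  then show ?thesis
    by (subst smooth_cong[OF pdy_frechet[OF assms]])
qed

lemma pdx_pdx_commute: "\<lbrakk>smooth f; x \<in> U; y \<noteq> 0\<rbrakk> \<Longrightarrow> pdx k (pdx l f) x y = pdx l (pdx k f) x y"
  and pdy_pdy_commute: "\<lbrakk>smooth f; x \<in> U; y \<noteq> 0\<rbrakk> \<Longrightarrow> pdy k (pdy l f) x y = pdy l (pdy k f) x y"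
  and pdx_pdy_commute: "\<lbrakk>smooth f; x \<in> U; y \<noteq> 0\<rbrakk> \<Longrightarrow> pdx k (pdy l f) x y = pdy l (pdx k f) x y"
proof -
  assume *: "smooth f" "x \<in> U" "y \<noteq> 0"
  let ?F = "\<lambda>(x, y). f x y"
  let ?D = "\<lambda>u g q. frechet_derivative g (at q) u"
  have x: "?D u (\<lambda>(x, y). pdx k f x y) (x, y) = ?D u (?D (axis k 1, 0) ?F) (x, y)" for u k
    using pdx_frechet[OF *(1)] *
    by (subst frechet_derivative_cong[OF open_domain, of "(x, y)" _ "?D (axis k 1, 0) ?F"]) auto
  have y: "?D u (\<lambda>(x, y). pdy k f x y) (x, y) = ?D u (?D (0, axis k 1) ?F) (x, y)" for u k
    using pdy_frechet[OF *(1)] *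
    by (subst frechet_derivative_cong[OF open_domain, of "(x, y)" _ "?D (0, axis k 1) ?F"]) auto
  have comm: "?D v (?D u ?F) (x, y) = ?D u (?D v ?F) (x, y)" for u v
    using mixed_derivatives_commute[OF open_domain, of ?F "(x, y)" v u] *
    by (auto simp: smooth_tfun_def smooth_on_def)
  show "pdx k (pdx l f) x y = pdx l (pdx k f) x y" "pdy k (pdy l f) x y = pdy l (pdy k f) x y"
    "pdx k (pdy l f) x y = pdy l (pdx k f) x y"
    using * comm by (simp_all add: pdx_frechet pdy_frechet x y)
qed

text \<open>The derivatives at a point of the domain only depend on the values near that point, so
  equations valid on the domain may be differentiated.\<close>

lemma pdx_cong:
  assumes "x \<in> U" "y \<noteq> 0" "\<And>x y. \<lbrakk>x \<in> U; y \<noteq> 0\<rbrakk> \<Longrightarrow> f x y = g x y"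
  shows "pdx k f x y = pdx k g x y"
proof -
  have "\<forall>\<^sub>F t in nhds 0. x + t *\<^sub>R axis k 1 \<in> U"
    by (rule topological_tendstoD[OF _ open_base])
      (use assms in \<open>auto intro!: tendsto_eq_intros filterlim_ident\<close>)
  then have "\<forall>\<^sub>F t in nhds 0. f (x + t *\<^sub>R axis k 1) y = g (x + t *\<^sub>R axis k 1) y"
    by eventually_elim (use assms in auto)
  then show ?thesis unfolding pdx_def by (rule deriv_cong_ev) simp
qed

lemma pdy_cong:
  assumes "x \<in> U" "y \<noteq> 0" "\<And>x y. \<lbrakk>x \<in> U; y \<noteq> 0\<rbrakk> \<Longrightarrow> f x y = g x y"
  shows "pdy k f x y = pdy k g x y"
proof -
  have "\<forall>\<^sub>F t in nhds 0. y + t *\<^sub>R axis k 1 \<in> - {0}"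
    by (rule topological_tendstoD)
      (use assms in \<open>auto intro!: tendsto_eq_intros filterlim_ident\<close>)
  then have "\<forall>\<^sub>F t in nhds 0. f x (y + t *\<^sub>R axis k 1) = g x (y + t *\<^sub>R axis k 1)"
    by eventually_elim (use assms in auto)
  then show ?thesis unfolding pdy_def by (rule deriv_cong_ev) simp
qed

lemma pdx_fibre [simp]: "pdx k (\<lambda>x y. s y) x y = 0"
  by (simp add: pdx_def)

lemma pdy_base [simp]: "pdy k (\<lambda>x y. s x) x y = 0"
  by (simp add: pdy_def)

lemma pdy_fibre_coord [simp]: "pdy k (\<lambda>x y. y $ i) x y = (if i = k then 1 else 0)"
proof -
  have "((\<lambda>t. (y + t *\<^sub>R axis k 1) $ i) has_field_derivative (if i = k then 1 else 0)) (at 0)"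
    by (auto intro!: derivative_eq_intros simp: axis_def)
  then show ?thesis unfolding pdy_def by (rule DERIV_imp_deriv)
qed

lemma
  assumes "smooth f" "smooth g" "x \<in> U" "y \<noteq> 0"
  shows pdx_add: "pdx k (\<lambda>x y. f x y + g x y) x y = pdx k f x y + pdx k g x y"
    and pdy_add: "pdy k (\<lambda>x y. f x y + g x y) x y = pdy k f x y + pdy k g x y"
    and pdx_diff: "pdx k (\<lambda>x y. f x y - g x y) x y = pdx k f x y - pdx k g x y"
    and pdy_diff: "pdy k (\<lambda>x y. f x y - g x y) x y = pdy k f x y - pdy k g x y"
    and pdx_mult: "pdx k (\<lambda>x y. f x y * g x y) x y = pdx k f x y * g x y + f x y * pdx k g x y"
    and pdy_mult: "pdy k (\<lambda>x y. f x y * g x y) x y = pdy k f x y * g x y + f x y * pdy k g x y"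
proof -
  note X = DERIV_pdx[OF assms(1,3,4), of k] DERIV_pdx[OF assms(2,3,4), of k]
  note Y = DERIV_pdy[OF assms(1,3,4), of k] DERIV_pdy[OF assms(2,3,4), of k]
  show "pdx k (\<lambda>x y. f x y + g x y) x y = pdx k f x y + pdx k g x y"
    unfolding pdx_def[of k "\<lambda>x y. f x y + g x y"] by (rule DERIV_imp_deriv[OF DERIV_add[OF X]])
  show "pdy k (\<lambda>x y. f x y + g x y) x y = pdy k f x y + pdy k g x y"
    unfolding pdy_def[of k "\<lambda>x y. f x y + g x y"] by (rule DERIV_imp_deriv[OF DERIV_add[OF Y]])
  show "pdx k (\<lambda>x y. f x y - g x y) x y = pdx k f x y - pdx k g x y"
    unfolding pdx_def[of k "\<lambda>x y. f x y - g x y"] by (rule DERIV_imp_deriv[OF DERIV_diff[OF X]])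
  show "pdy k (\<lambda>x y. f x y - g x y) x y = pdy k f x y - pdy k g x y"
    unfolding pdy_def[of k "\<lambda>x y. f x y - g x y"] by (rule DERIV_imp_deriv[OF DERIV_diff[OF Y]])
  show "pdx k (\<lambda>x y. f x y * g x y) x y = pdx k f x y * g x y + f x y * pdx k g x y"
    unfolding pdx_def[of k "\<lambda>x y. f x y * g x y"]
    using DERIV_imp_deriv[OF DERIV_mult[OF X]] by simp
  show "pdy k (\<lambda>x y. f x y * g x y) x y = pdy k f x y * g x y + f x y * pdy k g x y"
    unfolding pdy_def[of k "\<lambda>x y. f x y * g x y"]
    using DERIV_imp_deriv[OF DERIV_mult[OF Y]] by simp
qed

lemma
  assumes "smooth f" "x \<in> U" "y \<noteq> 0"
  shows pdx_divide: "pdx k (\<lambda>x y. f x y / a) x y = pdx k f x y / a"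
    and pdy_divide: "pdy k (\<lambda>x y. f x y / a) x y = pdy k f x y / a"
  using pdx_mult[OF assms(1) smooth_const assms(2,3), of k "inverse a"]
    pdy_mult[OF assms(1) smooth_const assms(2,3), of k "inverse a"]
  by (simp_all add: divide_inverse)

lemma pdx_sum: "\<lbrakk>\<And>i. smooth (f i); x \<in> U; y \<noteq> 0\<rbrakk> \<Longrightarrow> pdx k (\<lambda>x y. \<Sum>i\<in>I. f i x y) x y = (\<Sum>i\<in>I. pdx k (f i) x y)"
  by (induction I rule: infinite_finite_induct) (simp_all add: pdx_add)

lemma pdy_sum: "\<lbrakk>\<And>i. smooth (f i); x \<in> U; y \<noteq> 0\<rbrakk> \<Longrightarrow> pdy k (\<lambda>x y. \<Sum>i\<in>I. f i x y) x y = (\<Sum>i\<in>I. pdy k (f i) x y)"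
  by (induction I rule: infinite_finite_induct) (simp_all add: pdy_add)

lemmas pd_simps = pdx_add pdy_add pdx_diff pdy_diff pdx_mult pdy_mult pdx_sum pdy_sum pdx_divide pdy_divide

end

section \<open>Positive homogeneity in the fibre\<close>

lemma sum_Kronecker [simp]:
  fixes f :: "'n::finite \<Rightarrow> real"
  shows "(\<Sum>j\<in>UNIV. (if j = k then 1 else 0) * f j) = f k"
    and "(\<Sum>j\<in>UNIV. (if k = j then 1 else 0) * f j) = f k"
    and "(\<Sum>j\<in>UNIV. f j * (if j = k then 1 else 0)) = f k"
    and "(\<Sum>j\<in>UNIV. f j * (if k = j then 1 else 0)) = f k"
  by (simp_all add: if_distrib[of "\<lambda>z. z * _"] if_distrib[of "\<lambda>z. _ * z"] cong: if_cong)

context punctured_tangent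
begin

text \<open>Homogeneity of degree \<open>d\<close> in the form of Euler's identity. In this form it passes to products
  and derivatives by the product rule alone, without any scaling of the arguments.\<close>

definition homog :: "real \<Rightarrow> 'n tfun \<Rightarrow> bool" where
  "homog d f \<longleftrightarrow> (\<forall>x\<in>U. \<forall>y. y \<noteq> 0 \<longrightarrow> (\<Sum>j\<in>UNIV. y $ j * pdy j f x y) = d * f x y)"

lemma homogD: "\<lbrakk>homog d f; x \<in> U; y \<noteq> 0\<rbrakk> \<Longrightarrow> (\<Sum>j\<in>UNIV. y $ j * pdy j f x y) = d * f x y"
  by (simp add: homog_def)

text \<open>Differentiate both sides in \<open>l\<close> at \<open>l = 1\<close>; the left side is the derivative in the direction
  \<open>(0, y)\<close>.\<close>

lemma homogI:
  assumes "smooth f" and hom: "\<And>x y l. \<lbrakk>x \<in> U; y \<noteq> 0; l > 0\<rbrakk> \<Longrightarrow> f x (l *\<^sub>R y) = l ^ d * f x y"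
  shows "homog (real d) f"
  unfolding homog_def
proof (intro ballI allI impI)
  fix x y :: "real ^ 'n" assume xy: "x \<in> U" "y \<noteq> 0"
  let ?D = "frechet_derivative (\<lambda>(x, y). f x y) (at (x, y))"
  note D = has_derivative_uncurried[OF assms(1) xy]
  have "((\<lambda>l. (x, l *\<^sub>R y)) has_derivative (\<lambda>r. (0, r *\<^sub>R y))) (at 1)"
    by (auto intro!: derivative_eq_intros)
  from has_derivative_compose[OF this, of "\<lambda>(x, y). f x y" ?D] D
  have "((\<lambda>l. f x (l *\<^sub>R y)) has_derivative (\<lambda>r. ?D (0, r *\<^sub>R y))) (at 1)" by simp
  moreover have "?D (0, r *\<^sub>R y) = ?D (0, y) * r" for r
    using linear_cmul[OF has_derivative_linear[OF D], of r "(0, y)"] by simp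
  ultimately have 1: "((\<lambda>l. f x (l *\<^sub>R y)) has_real_derivative ?D (0, y)) (at 1)"
    by (simp add: has_field_derivative_def fun_eq_iff)
  have "((\<lambda>l. l ^ d * f x y) has_real_derivative real d * f x y) (at 1)"
    by (auto intro!: derivative_eq_intros)
  then have "((\<lambda>l. f x (l *\<^sub>R y)) has_real_derivative real d * f x y) (at 1)"
    by (rule has_field_derivative_transform_within_open[of _ _ _ "{0<..}"]) (use xy hom in auto)
  with 1 have "?D (0, y) = real d * f x y" by (rule DERIV_unique)
  moreover have "?D (0, y) = (\<Sum>j\<in>UNIV. y $ j * pdy j f x y)"
  proof -
    have "(0, y) = (\<Sum>j\<in>UNIV. y $ j *\<^sub>R (0 :: real ^ 'n, axis j 1))"
      using basis_expansion[of y] by (simp add: sum_prod scalar_mult_eq_scaleR)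
    then show ?thesis
      using linear_sum[OF has_derivative_linear[OF D], of "\<lambda>j. y $ j *\<^sub>R (0, axis j 1)" UNIV]
        linear_cmul[OF has_derivative_linear[OF D]] pdy_frechet[OF assms(1) xy]
      by (simp del: scaleR_Pair)
  qed
  ultimately show "(\<Sum>j\<in>UNIV. y $ j * pdy j f x y) = real d * f x y" by simp
qed

text \<open>Apply \<open>\<partial>/\<partial>y\<^sup>k\<close> to Euler's identity; the derivative of the factor \<open>y\<^sup>j\<close> lowers the degree.\<close>

lemma homog_pdy:
  assumes "smooth f" "homog d f" shows "homog (d - 1) (pdy k f)"
  unfolding homog_def
proof (intro ballI allI impI)
  fix x y :: "real ^ 'n" assume xy [simp]: "x \<in> U" "y \<noteq> 0"
  note [simp] = assms(1)
  have "pdy k (\<lambda>x y. \<Sum>j\<in>UNIV. y $ j * pdy j f x y) x y = pdy k (\<lambda>x y. d * f x y) x y"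
    by (rule pdy_cong) (use assms(2) in \<open>auto simp: homogD\<close>)
  then have "pdy k f x y + (\<Sum>j\<in>UNIV. y $ j * pdy k (pdy j f) x y) = d * pdy k f x y"
    by (simp add: pd_simps sum.distrib)
  moreover have "(\<Sum>j\<in>UNIV. y $ j * pdy k (pdy j f) x y) = (\<Sum>j\<in>UNIV. y $ j * pdy j (pdy k f) x y)"
    by (intro sum.cong refl) (simp add: pdy_pdy_commute[of f x y k])
  ultimately show "(\<Sum>j\<in>UNIV. y $ j * pdy j (pdy k f) x y) = (d - 1) * pdy k f x y"
    by (simp add: algebra_simps)
qed

lemma homog_pdx:
  assumes "smooth f" "homog d f" shows "homog d (pdx k f)"
  unfolding homog_def
proof (intro ballI allI impI)
  fix x y :: "real ^ 'n" assume xy [simp]: "x \<in> U" "y \<noteq> 0"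
  note [simp] = assms(1)
  have "pdx k (\<lambda>x y. \<Sum>j\<in>UNIV. y $ j * pdy j f x y) x y = pdx k (\<lambda>x y. d * f x y) x y"
    by (rule pdx_cong) (use assms(2) in \<open>auto simp: homogD\<close>)
  then have "(\<Sum>j\<in>UNIV. y $ j * pdx k (pdy j f) x y) = d * pdx k f x y"
    by (simp add: pd_simps sum.distrib)
  then show "(\<Sum>j\<in>UNIV. y $ j * pdy j (pdx k f) x y) = d * pdx k f x y"
    by (simp add: pdx_pdy_commute)
qed

lemma homog_add: "\<lbrakk>smooth f; smooth g; homog d f; homog d g\<rbrakk> \<Longrightarrow> homog d (\<lambda>x y. f x y + g x y)"
  and homog_diff: "\<lbrakk>smooth f; smooth g; homog d f; homog d g\<rbrakk> \<Longrightarrow> homog d (\<lambda>x y. f x y - g x y)"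
  by (simp_all add: homog_def pd_simps distrib_left right_diff_distrib sum.distrib sum_subtractf)

lemma homog_mult:
  assumes "smooth f" "smooth g" "homog d f" "homog e g"
  shows "homog (d + e) (\<lambda>x y. f x y * g x y)"
proof -
  have "(\<Sum>j\<in>UNIV. y $ j * (pdy j f x y * g x y + f x y * pdy j g x y)) =
    (\<Sum>j\<in>UNIV. y $ j * pdy j f x y) * g x y + f x y * (\<Sum>j\<in>UNIV. y $ j * pdy j g x y)" for x y
    by (simp add: sum_distrib_left sum_distrib_right sum.distrib algebra_simps)
  then show ?thesis using assms
    by (simp add: homog_def pd_simps algebra_simps)
qed

lemma homog_const: "homog 0 (\<lambda>x y. s x)"
  by (simp add: homog_def)

lemma homog_fibre_coord: "homog 1 (\<lambda>x y. y $ i)"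
  by (simp add: homog_def)

lemma homog_cmult: "\<lbrakk>smooth f; homog d f\<rbrakk> \<Longrightarrow> homog d (\<lambda>x y. a * f x y)"
  using homog_mult[of "\<lambda>x y. a" f 0 d] homog_const[of "\<lambda>x. a"] by simp

lemma homog_sum:
  assumes "\<And>i. smooth (f i)" "\<And>i. homog d (f i)"
  shows "homog d (\<lambda>x y. \<Sum>i\<in>I. f i x y)"
  by (induction I rule: infinite_finite_induct) (use assms in \<open>auto intro!: homog_add simp: homog_def[of _ "\<lambda>x y. 0"]\<close>)

end

section \<open>The spray as a derivation\<close>

text \<open>The spray as a vector field, applied to a function.\<close>

definition spray_deriv :: "'n::finite coeffs \<Rightarrow> 'n tfun \<Rightarrow> 'n tfun" where
  "spray_deriv G f = (\<lambda>x y. (\<Sum>j\<in>UNIV. y $ j * pdx j f x y) - 2 * (\<Sum>l\<in>UNIV. sprayc G l x y * pdy l f x y))"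

text \<open>The covariant derivative of a covector along the spray. It agrees with the contraction
  \<open>A\<^sub>k\<^sub>|\<^sub>m y\<^sup>m\<close> (lemma \<open>hcov1_fibre\<close>), but it is a first-order operator that involves \<open>N\<close> only.\<close>

definition cov_deriv :: "'n::finite coeffs \<Rightarrow> ('n \<Rightarrow> 'n tfun) \<Rightarrow> 'n \<Rightarrow> 'n tfun" where
  "cov_deriv G A k = (\<lambda>x y. spray_deriv G (A k) x y - (\<Sum>l\<in>UNIV. Nconn G l k x y * A l x y))"

locale local_spray = punctured_tangent U for U :: "(real ^ 'n::finite) set" +
  fixes G :: "'n coeffs"
  assumes smooth_sprayc [simp]: "smooth (sprayc G i)"
    and homog_sprayc: "homog 2 (sprayc G i)"
begin

lemma smooth_Nconn [simp]: "smooth (Nconn G i j)"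
  by (simp add: Nconn_def)

lemma homog_Nconn: "homog 1 (Nconn G i j)"
  using homog_pdy[OF smooth_sprayc homog_sprayc] by (simp add: Nconn_def)

lemma smooth_spray_deriv [simp]: "smooth f \<Longrightarrow> smooth (spray_deriv G f)"
  by (simp add: spray_deriv_def)

lemma smooth_hdelta [simp]: "smooth f \<Longrightarrow> smooth (hdelta G k f)"
  by (simp add: hdelta_def)

lemma smooth_cov_deriv [simp]: "(\<And>k. smooth (A k)) \<Longrightarrow> smooth (cov_deriv G A k)"
  by (simp add: cov_deriv_def)

lemma homog_spray_deriv:
  assumes "smooth f" "homog d f" shows "homog (d + 1) (spray_deriv G f)"
proof -
  have "homog (1 + d) (\<lambda>x y. y $ j * pdx j f x y)" for j
    by (intro homog_mult homog_fibre_coord homog_pdx assms) (use assms in simp_all)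
  moreover have "homog (2 + (d - 1)) (\<lambda>x y. sprayc G j x y * pdy j f x y)" for j
    by (intro homog_mult homog_sprayc homog_pdy assms) (use assms in simp_all)
  ultimately show ?thesis unfolding spray_deriv_def
    by (intro homog_diff homog_cmult homog_sum) (use assms in \<open>simp_all add: add.commute\<close>)
qed

text \<open>The operators \<open>\<G>\<close> and \<open>\<delta>/\<delta>x\<^sup>k\<close> are vector fields, hence derivations.\<close>

lemma
  assumes [simp]: "smooth f" "smooth g" and xy [simp]: "x \<in> U" "y \<noteq> 0"
  shows spray_deriv_add: "spray_deriv G (\<lambda>x y. f x y + g x y) x y = spray_deriv G f x y + spray_deriv G g x y"
    and spray_deriv_diff: "spray_deriv G (\<lambda>x y. f x y - g x y) x y = spray_deriv G f x y - spray_deriv G g x y"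
    and spray_deriv_mult: "spray_deriv G (\<lambda>x y. f x y * g x y) x y = spray_deriv G f x y * g x y + f x y * spray_deriv G g x y"
    and hdelta_add: "hdelta G k (\<lambda>x y. f x y + g x y) x y = hdelta G k f x y + hdelta G k g x y"
    and hdelta_diff: "hdelta G k (\<lambda>x y. f x y - g x y) x y = hdelta G k f x y - hdelta G k g x y"
    and hdelta_mult: "hdelta G k (\<lambda>x y. f x y * g x y) x y = hdelta G k f x y * g x y + f x y * hdelta G k g x y"
  by (simp_all add: spray_deriv_def hdelta_def pd_simps sum.distrib sum_subtractf sum_distrib_left sum_distrib_right algebra_simps)

lemma spray_deriv_sum:
  assumes "\<And>i. smooth (f i)" "x \<in> U" "y \<noteq> 0"
  shows "spray_deriv G (\<lambda>x y. \<Sum>i\<in>I. f i x y) x y = (\<Sum>i\<in>I. spray_deriv G (f i) x y)"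
  using assms
  by (induction I rule: infinite_finite_induct) (simp_all add: spray_deriv_add, simp_all add: spray_deriv_def)

lemma spray_deriv_cong:
  assumes "x \<in> U" "y \<noteq> 0" "\<And>x y. \<lbrakk>x \<in> U; y \<noteq> 0\<rbrakk> \<Longrightarrow> f x y = g x y"
  shows "spray_deriv G f x y = spray_deriv G g x y"
  using pdx_cong[OF assms] pdy_cong[OF assms] by (simp add: spray_deriv_def)

lemma hdelta_cong:
  assumes "x \<in> U" "y \<noteq> 0" "\<And>x y. \<lbrakk>x \<in> U; y \<noteq> 0\<rbrakk> \<Longrightarrow> f x y = g x y"
  shows "hdelta G k f x y = hdelta G k g x y"
  using pdx_cong[OF assms] pdy_cong[OF assms] by (simp add: hdelta_def)

lemma cov_deriv_cong:
  assumes "x \<in> U" "y \<noteq> 0" "\<And>k x y. \<lbrakk>x \<in> U; y \<noteq> 0\<rbrakk> \<Longrightarrow> A k x y = B k x y"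
  shows "cov_deriv G A k x y = cov_deriv G B k x y"
  using spray_deriv_cong[OF assms(1,2), of "A k" "B k"] assms by (simp add: cov_deriv_def)

text \<open>The bracket \<open>[\<partial>/\<partial>y\<^sup>k, \<G>] = \<partial>/\<partial>x\<^sup>k - 2 N\<^sup>l\<^sub>k \<partial>/\<partial>y\<^sup>l\<close>.\<close>

lemma pdy_spray_deriv:
  assumes [simp]: "smooth f" "x \<in> U" "y \<noteq> 0"
  shows "pdy k (spray_deriv G f) x y = spray_deriv G (pdy k f) x y + pdx k f x y
    - 2 * (\<Sum>l\<in>UNIV. Nconn G l k x y * pdy l f x y)"
  unfolding spray_deriv_def
  by (simp add: pd_simps sum.distrib Nconn_def pdx_pdy_commute pdy_pdy_commute[of f _ _ k])

lemma pdx_spray_deriv: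
  assumes [simp]: "smooth f" "x \<in> U" "y \<noteq> 0"
  shows "pdx k (spray_deriv G f) x y = spray_deriv G (pdx k f) x y
    - 2 * (\<Sum>l\<in>UNIV. pdx k (sprayc G l) x y * pdy l f x y)"
  unfolding spray_deriv_def
  by (simp add: pd_simps sum.distrib pdx_pdy_commute pdx_pdx_commute[of f _ _ k])

text \<open>The bracket is \<open>\<delta>/\<delta>x\<^sup>k - N\<^sup>l\<^sub>k \<partial>/\<partial>y\<^sup>l\<close>, and its vertical part is what turns \<open>\<G>\<close> into \<open>D\<close>.\<close>

lemma pdy_spray_deriv_cov:
  assumes [simp]: "smooth f" "x \<in> U" "y \<noteq> 0"
  shows "pdy k (spray_deriv G f) x y = cov_deriv G (\<lambda>j. pdy j f) k x y + hdelta G k f x y"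
  by (simp add: pdy_spray_deriv cov_deriv_def hdelta_def)

text \<open>The two middle terms in the definition of the Riemann curvature are \<open>- \<G> N\<^sup>i\<^sub>k\<close>.\<close>

lemma Riem_spray_deriv:
  "Riem G i k x y = 2 * pdx k (sprayc G i) x y - spray_deriv G (Nconn G i k) x y
    - (\<Sum>s\<in>UNIV. Nconn G i s x y * Nconn G s k x y)"
  by (simp add: Riem_def spray_deriv_def Nconn_def)

text \<open>The second-order terms of \<open>\<G> \<delta>\<^sub>k f\<close> and \<open>\<delta>\<^sub>k \<G> f\<close> agree. What is left is vertical, with
  coefficients \<open>2 \<partial>G\<^sup>m/\<partial>x\<^sup>k - \<G> N\<^sup>m\<^sub>k - N\<^sup>m\<^sub>s N\<^sup>s\<^sub>k\<close>.\<close>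

lemma cov_deriv_hdelta:
  assumes [simp]: "smooth f" "x \<in> U" "y \<noteq> 0"
  shows "cov_deriv G (\<lambda>j. hdelta G j f) k x y
    = hdelta G k (spray_deriv G f) x y + (\<Sum>m\<in>UNIV. Riem G m k x y * pdy m f x y)"
proof -
  have *: "spray_deriv G (hdelta G k f) x y = spray_deriv G (pdx k f) x y
     - (\<Sum>l\<in>UNIV. spray_deriv G (Nconn G l k) x y * pdy l f x y + Nconn G l k x y * spray_deriv G (pdy l f) x y)"
    unfolding hdelta_def by (simp add: spray_deriv_diff spray_deriv_sum spray_deriv_mult)
  have **: "hdelta G k (spray_deriv G f) x y = spray_deriv G (pdx k f) x y
    - 2 * (\<Sum>l\<in>UNIV. pdx k (sprayc G l) x y * pdy l f x y)
    - (\<Sum>l\<in>UNIV. Nconn G l k x y * (spray_deriv G (pdy l f) x y + pdx l f x y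
         - 2 * (\<Sum>s\<in>UNIV. Nconn G s l x y * pdy s f x y)))"
    by (simp add: hdelta_def[of _ _ "spray_deriv G f"] pdx_spray_deriv pdy_spray_deriv)
  have swap: "(\<Sum>m\<in>UNIV. (\<Sum>s\<in>UNIV. Nconn G m s x y * Nconn G s k x y) * pdy m f x y)
    = (\<Sum>l\<in>UNIV. Nconn G l k x y * (\<Sum>s\<in>UNIV. Nconn G s l x y * pdy s f x y))"
    unfolding sum_distrib_left sum_distrib_right
    by (subst sum.swap) (simp add: mult_ac)
  show ?thesis
    unfolding cov_deriv_def * ** Riem_spray_deriv left_diff_distrib sum_subtractf swap
    unfolding hdelta_def[of _ _ f]
    by (simp add: algebra_simps sum.distrib sum_subtractf sum_distrib_left)
qed

lemma sum_Nconn_fibre: "\<lbrakk>x \<in> U; y \<noteq> 0\<rbrakk> \<Longrightarrow> (\<Sum>m\<in>UNIV. y $ m * Nconn G l m x y) = 2 * sprayc G l x y"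
  using homogD[OF homog_sprayc] by (simp add: Nconn_def)

lemma sum_Berwald_fibre:
  assumes "x \<in> U" "y \<noteq> 0"
  shows "(\<Sum>m\<in>UNIV. y $ m * Berwald G l k m x y) = Nconn G l k x y"
proof -
  have "Berwald G l k m x y = pdy m (Nconn G l k) x y" for m
    using assms by (simp add: Berwald_def Nconn_def pdy_pdy_commute)
  then show ?thesis using homogD[OF homog_Nconn] assms by simp
qed

text \<open>Euler's identities \<open>N\<^sup>l\<^sub>m y\<^sup>m = 2 G\<^sup>l\<close> and \<open>\<Gamma>\<^sup>l\<^sub>k\<^sub>m y\<^sup>m = N\<^sup>l\<^sub>k\<close> remove the connection coefficients.\<close>

lemma hcov1_fibre:
  assumes "x \<in> U" "y \<noteq> 0"
  shows "(\<Sum>m\<in>UNIV. hcov1 G A k m x y * y $ m) = cov_deriv G A k x y"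
proof -
  have N: "(\<Sum>m\<in>UNIV. y $ m * (\<Sum>l\<in>UNIV. Nconn G l m x y * pdy l (A k) x y))
    = 2 * (\<Sum>l\<in>UNIV. sprayc G l x y * pdy l (A k) x y)"
  proof -
    have "(\<Sum>m\<in>UNIV. y $ m * (\<Sum>l\<in>UNIV. Nconn G l m x y * pdy l (A k) x y))
      = (\<Sum>l\<in>UNIV. (\<Sum>m\<in>UNIV. y $ m * Nconn G l m x y) * pdy l (A k) x y)"
      unfolding sum_distrib_left sum_distrib_right by (subst sum.swap) (simp add: mult_ac)
    then show ?thesis by (simp add: sum_Nconn_fibre assms sum_distrib_left mult_ac)
  qed
  have B: "(\<Sum>m\<in>UNIV. y $ m * (\<Sum>l\<in>UNIV. Berwald G l k m x y * A l x y))
      = (\<Sum>l\<in>UNIV. Nconn G l k x y * A l x y)"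
  proof -
    have "(\<Sum>m\<in>UNIV. y $ m * (\<Sum>l\<in>UNIV. Berwald G l k m x y * A l x y))
      = (\<Sum>l\<in>UNIV. (\<Sum>m\<in>UNIV. y $ m * Berwald G l k m x y) * A l x y)"
      unfolding sum_distrib_left sum_distrib_right by (subst sum.swap) (simp add: mult_ac)
    then show ?thesis by (simp add: sum_Berwald_fibre assms)
  qed
  have "(\<Sum>m\<in>UNIV. hcov1 G A k m x y * y $ m) = (\<Sum>m\<in>UNIV. y $ m * pdx m (A k) x y)
      - (\<Sum>m\<in>UNIV. y $ m * (\<Sum>l\<in>UNIV. Nconn G l m x y * pdy l (A k) x y))
      - (\<Sum>m\<in>UNIV. y $ m * (\<Sum>l\<in>UNIV. Berwald G l k m x y * A l x y))"
    unfolding hcov1_def hdelta_def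
    by (simp only: left_diff_distrib sum_subtractf mult.commute[of "y $ _"])
  then show ?thesis unfolding N B cov_deriv_def spray_deriv_def by simp
qed

lemma cov_deriv_diff:
  assumes "\<And>k. smooth (A k)" "\<And>k. smooth (B k)" "x \<in> U" "y \<noteq> 0"
  shows "cov_deriv G (\<lambda>k x y. A k x y - B k x y) k x y = cov_deriv G A k x y - cov_deriv G B k x y"
  using assms by (simp add: cov_deriv_def spray_deriv_diff right_diff_distrib sum_subtractf)

lemma cov_deriv_add:
  assumes "\<And>k. smooth (A k)" "\<And>k. smooth (B k)" "x \<in> U" "y \<noteq> 0"
  shows "cov_deriv G (\<lambda>k x y. A k x y + B k x y) k x y = cov_deriv G A k x y + cov_deriv G B k x y"
  using assms by (simp add: cov_deriv_def spray_deriv_add distrib_left sum.distrib)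

lemma cov_deriv_mult:
  assumes "smooth f" "\<And>k. smooth (A k)" "x \<in> U" "y \<noteq> 0"
  shows "cov_deriv G (\<lambda>k x y. f x y * A k x y) k x y
    = spray_deriv G f x y * A k x y + f x y * cov_deriv G A k x y"
  using assms by (simp add: cov_deriv_def spray_deriv_mult right_diff_distrib sum_distrib_left mult_ac)

lemma spray_deriv_const [simp]: "spray_deriv G (\<lambda>x y. a) x y = 0"
  by (simp add: spray_deriv_def)

lemma hdelta_const [simp]: "hdelta G k (\<lambda>x y. a) x y = 0"
  by (simp add: hdelta_def)

section \<open>Curvatures through the spray derivation\<close>

lemma Riem_eq:
  "Riem G i k = (\<lambda>x y. 2 * pdx k (sprayc G i) x y - spray_deriv G (Nconn G i k) x y
    - (\<Sum>s\<in>UNIV. Nconn G i s x y * Nconn G s k x y))"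
  by (intro ext) (rule Riem_spray_deriv)

lemma smooth_Riem [simp]: "smooth (Riem G i k)"
  unfolding Riem_eq by simp

lemma homog_Riem: "homog 2 (Riem G i k)"
proof -
  have "homog 2 (spray_deriv G (Nconn G i k))"
    using homog_spray_deriv[OF smooth_Nconn homog_Nconn, of i k] by simp
  moreover have "homog 2 (\<lambda>x y. Nconn G i s x y * Nconn G s k x y)" for s
    using homog_mult[OF smooth_Nconn smooth_Nconn homog_Nconn homog_Nconn, of i s s k] by simp
  ultimately show ?thesis
    unfolding Riem_eq by (intro homog_diff homog_cmult homog_sum homog_pdx homog_sprayc) simp_all
qed

lemma smooth_Ricci [simp]: "smooth (Ricci G)"
  unfolding Ricci_def by simp

lemma homog_Ricci: "homog 2 (Ricci G)"
  unfolding Ricci_def by (intro homog_sum homog_Riem) simp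

lemma Ricci_scalar_eq: "Ricci_scalar G = (\<lambda>x y. 1 / (real CARD('n) - 1) * Ricci G x y)"
  by (simp add: Ricci_scalar_def)

lemma smooth_Ricci_scalar [simp]: "smooth (Ricci_scalar G)"
  unfolding Ricci_scalar_eq by simp

lemma homog_Ricci_scalar: "homog 2 (Ricci_scalar G)"
  unfolding Ricci_scalar_eq by (intro homog_cmult homog_Ricci) simp

text \<open>The divergence \<open>\<Pi> = \<partial>G\<^sup>m/\<partial>y\<^sup>m\<close>, the part of the S-curvature that does not depend on the volume
  form.\<close>

definition trace_N :: "'n tfun" where
  "trace_N = (\<lambda>x y. \<Sum>m\<in>UNIV. Nconn G m m x y)"

lemma smooth_trace_N [simp]: "smooth trace_N"
  by (simp add: trace_N_def)

lemma homog_trace_N: "homog 1 trace_N"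
  unfolding trace_N_def by (intro homog_sum homog_Nconn) simp

lemma pdy_Nconn_commute:
  "\<lbrakk>x \<in> U; y \<noteq> 0\<rbrakk> \<Longrightarrow> pdy l (Nconn G i k) x y = pdy k (Nconn G i l) x y"
  by (simp add: Nconn_def pdy_pdy_commute[of _ _ _ l k])

text \<open>This formula and the next one contain the same two sums that are not expressible by \<open>\<Pi>\<close>, namely
  \<open>\<partial>N\<^sup>m\<^sub>k/\<partial>x\<^sup>m\<close> and \<open>N\<^sup>m\<^sub>l \<partial>N\<^sup>l\<^sub>m/\<partial>y\<^sup>k\<close>, with coefficients \<open>-1, 1\<close> here and \<open>2, -2\<close> there. They cancel
  in the combination of lemma \<open>chi_curv_Riem\<close>.\<close>

lemma divergence_Riem:
  assumes xy [simp]: "x \<in> U" "y \<noteq> 0"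
  shows "(\<Sum>m\<in>UNIV. pdy m (Riem G m k) x y) = 2 * pdx k trace_N x y
     - spray_deriv G (pdy k trace_N) x y - (\<Sum>m\<in>UNIV. pdx m (Nconn G m k) x y)
     + (\<Sum>m\<in>UNIV. \<Sum>l\<in>UNIV. Nconn G m l x y * pdy k (Nconn G l m) x y)
     - (\<Sum>s\<in>UNIV. Nconn G s k x y * pdy s trace_N x y)"
proof -
  have a: "(\<Sum>m\<in>UNIV. pdy m (pdx k (sprayc G m)) x y) = pdx k trace_N x y"
    unfolding trace_N_def by (simp add: pd_simps Nconn_def pdx_pdy_commute)
  have pdyT: "pdy l trace_N x y = (\<Sum>m\<in>UNIV. pdy m (Nconn G m l) x y)" if "x \<in> U" "y \<noteq> 0" for l x y
    unfolding trace_N_def using that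
    by (simp add: pd_simps) (intro sum.cong refl pdy_Nconn_commute)
  have b: "(\<Sum>m\<in>UNIV. spray_deriv G (pdy m (Nconn G m k)) x y) = spray_deriv G (pdy k trace_N) x y"
    using spray_deriv_cong[OF xy, of "pdy k trace_N" "\<lambda>x y. \<Sum>m\<in>UNIV. pdy m (Nconn G m k) x y"] pdyT
    by (simp add: spray_deriv_sum)
  have c: "(\<Sum>m\<in>UNIV. \<Sum>l\<in>UNIV. Nconn G l m x y * pdy l (Nconn G m k) x y)
    = (\<Sum>m\<in>UNIV. \<Sum>l\<in>UNIV. Nconn G m l x y * pdy k (Nconn G l m) x y)"
    by (subst sum.swap) (intro sum.cong refl arg_cong2[where f = "(*)"] pdy_Nconn_commute xy)
  have d: "(\<Sum>m\<in>UNIV. \<Sum>s\<in>UNIV. pdy m (Nconn G m s) x y * Nconn G s k x y)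
    = (\<Sum>s\<in>UNIV. Nconn G s k x y * pdy s trace_N x y)"
    by (subst sum.swap) (simp add: pdyT sum_distrib_left mult.commute)
  have e: "(\<Sum>m\<in>UNIV. \<Sum>s\<in>UNIV. Nconn G m s x y * pdy m (Nconn G s k) x y)
    = (\<Sum>m\<in>UNIV. \<Sum>l\<in>UNIV. Nconn G m l x y * pdy k (Nconn G l m) x y)"
    by (intro sum.cong refl arg_cong2[where f = "(*)"] pdy_Nconn_commute xy)
  have "(\<Sum>m\<in>UNIV. pdy m (Riem G m k) x y)
    = 2 * (\<Sum>m\<in>UNIV. pdy m (pdx k (sprayc G m)) x y)
      - (\<Sum>m\<in>UNIV. spray_deriv G (pdy m (Nconn G m k)) x y)
      - (\<Sum>m\<in>UNIV. pdx m (Nconn G m k) x y)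
      + 2 * (\<Sum>m\<in>UNIV. \<Sum>l\<in>UNIV. Nconn G l m x y * pdy l (Nconn G m k) x y)
      - (\<Sum>m\<in>UNIV. \<Sum>s\<in>UNIV. pdy m (Nconn G m s) x y * Nconn G s k x y)
      - (\<Sum>m\<in>UNIV. \<Sum>s\<in>UNIV. Nconn G m s x y * pdy m (Nconn G s k) x y)"
    unfolding Riem_eq
    by (simp add: pd_simps pdy_spray_deriv sum.distrib sum_subtractf sum_distrib_left)
  then show ?thesis unfolding a b c d e by simp
qed

lemma pdy_Ricci:
  assumes xy [simp]: "x \<in> U" "y \<noteq> 0"
  shows "pdy k (Ricci G) x y = 2 * (\<Sum>m\<in>UNIV. pdx m (Nconn G m k) x y)
     - spray_deriv G (pdy k trace_N) x y - pdx k trace_N x y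
     + 2 * (\<Sum>s\<in>UNIV. Nconn G s k x y * pdy s trace_N x y)
     - 2 * (\<Sum>m\<in>UNIV. \<Sum>l\<in>UNIV. Nconn G m l x y * pdy k (Nconn G l m) x y)"
proof -
  have pdyT: "pdy l trace_N x y = (\<Sum>m\<in>UNIV. pdy l (Nconn G m m) x y)" if "x \<in> U" "y \<noteq> 0" for l x y
    unfolding trace_N_def using that by (simp add: pd_simps)
  have a: "(\<Sum>m\<in>UNIV. pdy k (pdx m (sprayc G m)) x y) = (\<Sum>m\<in>UNIV. pdx m (Nconn G m k) x y)"
    by (simp add: Nconn_def pdx_pdy_commute)
  have b: "(\<Sum>m\<in>UNIV. spray_deriv G (pdy k (Nconn G m m)) x y) = spray_deriv G (pdy k trace_N) x y"
    using spray_deriv_cong[OF xy, of "pdy k trace_N" "\<lambda>x y. \<Sum>m\<in>UNIV. pdy k (Nconn G m m) x y"] pdyT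
    by (simp add: spray_deriv_sum)
  have b': "(\<Sum>m\<in>UNIV. pdx k (Nconn G m m) x y) = pdx k trace_N x y"
    unfolding trace_N_def by (simp add: pd_simps)
  have c: "(\<Sum>m\<in>UNIV. \<Sum>l\<in>UNIV. Nconn G l k x y * pdy l (Nconn G m m) x y)
    = (\<Sum>s\<in>UNIV. Nconn G s k x y * pdy s trace_N x y)"
    by (subst sum.swap) (simp add: pdyT sum_distrib_left)
  have d: "(\<Sum>m\<in>UNIV. \<Sum>s\<in>UNIV. pdy k (Nconn G m s) x y * Nconn G s m x y)
    = (\<Sum>m\<in>UNIV. \<Sum>l\<in>UNIV. Nconn G m l x y * pdy k (Nconn G l m) x y)"
    by (subst sum.swap) (simp add: mult.commute)
  have "pdy k (Ricci G) x y
    = 2 * (\<Sum>m\<in>UNIV. pdy k (pdx m (sprayc G m)) x y)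
      - (\<Sum>m\<in>UNIV. spray_deriv G (pdy k (Nconn G m m)) x y)
      - (\<Sum>m\<in>UNIV. pdx k (Nconn G m m) x y)
      + 2 * (\<Sum>m\<in>UNIV. \<Sum>l\<in>UNIV. Nconn G l k x y * pdy l (Nconn G m m) x y)
      - (\<Sum>m\<in>UNIV. \<Sum>s\<in>UNIV. pdy k (Nconn G m s) x y * Nconn G s m x y)
      - (\<Sum>m\<in>UNIV. \<Sum>s\<in>UNIV. Nconn G m s x y * pdy k (Nconn G s m) x y)"
    unfolding Ricci_def Riem_eq
    by (simp add: pd_simps pdy_spray_deriv sum.distrib sum_subtractf sum_distrib_left)
  then show ?thesis unfolding a b b' c d by simp
qed

text \<open>The trace terms of \<open>T\<close> contribute \<open>(n - 1)/2 R\<^sub>\<cdot>\<^sub>k\<close>, that is, half the derivative of the Ricci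
  curvature.\<close>

lemma chi_curv_Riem:
  assumes xy [simp]: "x \<in> U" "y \<noteq> 0" and n: "CARD('n) \<ge> 2"
  shows "chi_curv G k x y = - (1/6) * (2 * (\<Sum>m\<in>UNIV. pdy m (Riem G m k) x y) + pdy k (Ricci G) x y)"
proof -
  have "homog (2 - 1) (pdy k (Ricci_scalar G))"
    by (intro homog_pdy homog_Ricci_scalar) simp
  from homogD[OF this xy]
  have h: "(\<Sum>m\<in>UNIV. pdy m (pdy k (Ricci_scalar G)) x y * y $ m) = pdy k (Ricci_scalar G) x y"
    by (simp add: mult.commute)
  have "(\<Sum>m\<in>UNIV. pdy m (Tcurv G m k) x y) = (\<Sum>m\<in>UNIV. pdy m (Riem G m k) x y)
     - (\<Sum>m\<in>UNIV. pdy m (Ricci_scalar G) x y * (if m = k then 1 else 0))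
     + 1/2 * (\<Sum>m\<in>UNIV. pdy m (pdy k (Ricci_scalar G)) x y * y $ m)
     + 1/2 * (real CARD('n) * pdy k (Ricci_scalar G) x y)"
    unfolding Tcurv_def
    by (simp add: pd_simps sum.distrib sum_subtractf sum_distrib_left add_divide_distrib)
  moreover have "pdy k (Ricci_scalar G) x y = pdy k (Ricci G) x y / (real CARD('n) - 1)"
    unfolding Ricci_scalar_eq by (simp add: pd_simps)
  then have "pdy k (Ricci G) x y = (real CARD('n) - 1) * pdy k (Ricci_scalar G) x y"
    using n by (simp add: field_simps)
  ultimately show ?thesis
    unfolding chi_curv_def h sum_Kronecker by (simp add: algebra_simps)
qed

lemma chi_curv_trace_N:
  assumes xy [simp]: "x \<in> U" "y \<noteq> 0" and n: "CARD('n) \<ge> 2"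
  shows "chi_curv G k x y = 1/2 * (cov_deriv G (\<lambda>j. pdy j trace_N) k x y - hdelta G k trace_N x y)"
  unfolding chi_curv_Riem[OF assms] divergence_Riem[OF xy] pdy_Ricci[OF xy] cov_deriv_def hdelta_def
  by (simp add: algebra_simps)

text \<open>For a function \<open>s\<close> on the base, \<open>b = \<G> s\<close> is the 1-form \<open>ds\<close> as a function of \<open>y\<close>. The first
  commutation rule gives \<open>b\<^sub>\<cdot>\<^sub>j = s\<^sub>|\<^sub>j\<close>, and the second one then applies without its curvature term,
  since \<open>s\<close> has no vertical derivative. This is why the volume form drops out of \<open>\<chi>\<close>.\<close>

lemma cov_deriv_pdy_exact_form:
  assumes "smooth (\<lambda>x y. s x)" and xy [simp]: "x \<in> U" "y \<noteq> 0"
  defines "b \<equiv> spray_deriv G (\<lambda>x y. s x)"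
  shows "cov_deriv G (\<lambda>j. pdy j b) k x y = hdelta G k b x y"
proof -
  note [simp] = assms(1)
  have 0: "pdy j (\<lambda>x y. s x) = (\<lambda>x y. 0)" for j
    by (intro ext) simp
  have "pdy j b x y = hdelta G j (\<lambda>x y. s x) x y" if "x \<in> U" "y \<noteq> 0" for j x y
    using that by (simp add: b_def pdy_spray_deriv_cov 0 cov_deriv_def)
  then have "cov_deriv G (\<lambda>j. pdy j b) k x y = cov_deriv G (\<lambda>j. hdelta G j (\<lambda>x y. s x)) k x y"
    by (intro cov_deriv_cong xy)
  then show ?thesis by (simp add: cov_deriv_hdelta b_def)
qed

context
  fixes \<sigma> :: "real ^ 'n \<Rightarrow> real"
  assumes smooth_ln_density [simp]: "smooth (\<lambda>x y. ln (\<sigma> x))"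
begin

text \<open>The volume form enters through \<open>y\<^sup>m \<partial>(ln \<sigma>)/\<partial>x\<^sup>m = \<G> (ln \<sigma>)\<close>.\<close>

lemma S_curv_eq: "S_curv G \<sigma> = (\<lambda>x y. trace_N x y - spray_deriv G (\<lambda>x y. ln (\<sigma> x)) x y)"
  by (intro ext) (simp add: S_curv_def trace_N_def Nconn_def spray_deriv_def)

lemma smooth_S_curv [simp]: "smooth (S_curv G \<sigma>)"
  by (simp add: S_curv_eq)

lemma homog_S_curv: "homog 1 (S_curv G \<sigma>)"
  unfolding S_curv_eq
  using homog_spray_deriv[OF smooth_ln_density homog_const]
  by (intro homog_diff homog_trace_N) simp_all

lemma chi_curv_S_curv:
  assumes xy [simp]: "x \<in> U" "y \<noteq> 0" and n: "CARD('n) \<ge> 2"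
  shows "chi_curv G k x y = 1/2 * (cov_deriv G (\<lambda>j. pdy j (S_curv G \<sigma>)) k x y - hdelta G k (S_curv G \<sigma>) x y)"
proof -
  let ?b = "spray_deriv G (\<lambda>x y. ln (\<sigma> x))"
  have "cov_deriv G (\<lambda>j. pdy j (S_curv G \<sigma>)) k x y
    = cov_deriv G (\<lambda>j x y. pdy j trace_N x y - pdy j ?b x y) k x y"
    by (intro cov_deriv_cong xy) (simp add: S_curv_eq pd_simps)
  also have "\<dots> = cov_deriv G (\<lambda>j. pdy j trace_N) k x y - hdelta G k ?b x y"
    by (simp add: cov_deriv_diff cov_deriv_pdy_exact_form)
  finally show ?thesis
    by (simp add: chi_curv_trace_N[OF assms] S_curv_eq hdelta_diff)
qed

end

text \<open>Both \<open>\<Xi>\<^sub>\<cdot>\<close> and \<open>\<Xi>\<^sub>|\<close> come from the commutation rules. The combination \<open>q\<^sub>j - P\<^sub>|\<^sub>j\<close> is a multiple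
  of \<open>\<chi>\<^sub>j\<close> when \<open>P\<close> is a multiple of the S-curvature.\<close>

lemma Berwald_Weyl_operator_riccati:
  assumes [simp]: "smooth P" and xy [simp]: "x \<in> U" "y \<noteq> 0"
  defines "\<Xi> \<equiv> \<lambda>x y. P x y * P x y - spray_deriv G P x y"
    and "q \<equiv> cov_deriv G (\<lambda>j. pdy j P)"
  shows "hdelta G k \<Xi> x y - 1/2 * cov_deriv G (\<lambda>j. pdy j \<Xi>) k x y
    = 1/2 * cov_deriv G (\<lambda>j x y. q j x y - hdelta G j P x y) k x y
      + (\<Sum>m\<in>UNIV. Riem G m k x y * pdy m P x y)
      + P x y * (2 * hdelta G k P x y - q k x y) - spray_deriv G P x y * pdy k P x y"
proof -
  have [simp]: "smooth (q j)" for j by (simp add: q_def)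
  have "pdy j \<Xi> x y = 2 * P x y * pdy j P x y - (q j x y + hdelta G j P x y)" if "x \<in> U" "y \<noteq> 0" for j x y
    unfolding \<Xi>_def q_def using that by (simp add: pd_simps pdy_spray_deriv_cov)
  then have "cov_deriv G (\<lambda>j. pdy j \<Xi>) k x y
     = cov_deriv G (\<lambda>j x y. 2 * P x y * pdy j P x y - (q j x y + hdelta G j P x y)) k x y"
    by (intro cov_deriv_cong xy)
  also have "\<dots> = 2 * spray_deriv G P x y * pdy k P x y + 2 * P x y * q k x y
     - cov_deriv G q k x y - cov_deriv G (\<lambda>j. hdelta G j P) k x y"
    using cov_deriv_mult[of "\<lambda>x y. 2 * P x y" "\<lambda>j. pdy j P" x y k]
    by (simp add: cov_deriv_diff cov_deriv_add spray_deriv_mult q_def)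
  finally have 1: "cov_deriv G (\<lambda>j. pdy j \<Xi>) k x y = \<dots>" .
  have 2: "hdelta G k \<Xi> x y = 2 * P x y * hdelta G k P x y - hdelta G k (spray_deriv G P) x y"
    unfolding \<Xi>_def by (simp add: hdelta_diff hdelta_mult)
  show ?thesis unfolding 1 2
    using cov_deriv_hdelta[of P x y k] by (simp add: cov_deriv_diff algebra_simps)
qed

end

section \<open>Projective change of the spray\<close>

text \<open>The sprays with the same unparametrised geodesics as \<open>G\<close> have this form, with \<open>P\<close> of degree one.\<close>

definition proj_change :: "'n::finite coeffs \<Rightarrow> 'n tfun \<Rightarrow> 'n coeffs" where
  "proj_change G P = (\<lambda>x y. G x y + P x y *\<^sub>R y)"

lemma sprayc_proj_change: "sprayc (proj_change G P) i = (\<lambda>x y. sprayc G i x y + P x y * y $ i)"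
  by (simp add: sprayc_def proj_change_def)

lemma projective_spray_eq_proj_change:
  "projective_spray G \<sigma> = proj_change G (\<lambda>x y. - (1 / (real CARD('n) + 1)) * S_curv G \<sigma> x y)"
  for G :: "'n::finite coeffs"
  by (intro ext) (simp add: projective_spray_def proj_change_def)

context local_spray
begin

context
  fixes P :: "'n tfun"
  assumes smooth_factor [simp]: "smooth P" and homog_factor: "homog 1 P"
begin

lemma local_spray_proj_change: "local_spray U (proj_change G P)"
proof unfold_locales
  fix i
  show "smooth (sprayc (proj_change G P) i)" by (simp add: sprayc_proj_change)
  have "homog 2 (\<lambda>x y. P x y * y $ i)"
    using homog_mult[OF _ _ homog_factor homog_fibre_coord] by simp
  then show "homog 2 (sprayc (proj_change G P) i)"
    unfolding sprayc_proj_change by (intro homog_add homog_sprayc) simp_all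
qed

lemma Nconn_proj_change:
  assumes [simp]: "x \<in> U" "y \<noteq> 0"
  shows "Nconn (proj_change G P) i k x y
    = Nconn G i k x y + pdy k P x y * y $ i + P x y * (if i = k then 1 else 0)"
  by (simp add: Nconn_def sprayc_proj_change pd_simps)

lemma spray_deriv_proj_change:
  "spray_deriv (proj_change G P) f x y
    = spray_deriv G f x y - 2 * P x y * (\<Sum>l\<in>UNIV. y $ l * pdy l f x y)"
  by (simp add: spray_deriv_def sprayc_proj_change algebra_simps sum.distrib sum_distrib_left)

lemma sum_Nconn_proj_change:
  assumes "x \<in> U" "y \<noteq> 0"
  shows "(\<Sum>l\<in>UNIV. Nconn (proj_change G P) l k x y * A l)
    = (\<Sum>l\<in>UNIV. Nconn G l k x y * A l) + pdy k P x y * (\<Sum>l\<in>UNIV. y $ l * A l) + P x y * A k"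
proof -
  have "(\<Sum>l\<in>UNIV. P x y * (if l = k then 1 else 0) * A l) = P x y * A k"
    using sum_Kronecker(1)[of k "\<lambda>l. P x y * A l"] by (simp add: mult_ac)
  then show ?thesis
    by (simp add: Nconn_proj_change[OF assms] distrib_right sum.distrib) (simp add: sum_distrib_left mult_ac)
qed

text \<open>\<open>N\<^sup>l\<^sub>k\<close> changes by \<open>P\<^sub>\<cdot>\<^sub>k y\<^sup>l + P \<delta>\<^sup>l\<^sub>k\<close> and \<open>\<G>\<close> by \<open>- 2 P y\<^sup>l \<partial>/\<partial>y\<^sup>l\<close>; on \<open>f\<close> and on \<open>f\<^sub>\<cdot>\<^sub>k\<close> the fields
  \<open>y\<^sup>l \<partial>/\<partial>y\<^sup>l\<close> act as multiplication by two and by one.\<close>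

lemma Berwald_Weyl_operator_proj_change:
  assumes xy [simp]: "x \<in> U" "y \<noteq> 0" and [simp]: "smooth f" and f: "homog 2 f"
  shows "hdelta (proj_change G P) k f x y - 1/2 * cov_deriv (proj_change G P) (\<lambda>j. pdy j f) k x y
    = hdelta G k f x y - 1/2 * cov_deriv G (\<lambda>j. pdy j f) k x y
      + 1/2 * P x y * pdy k f x y - pdy k P x y * f x y"
proof -
  have 1: "(\<Sum>l\<in>UNIV. y $ l * pdy l f x y) = 2 * f x y" by (rule homogD[OF f xy])
  have 2: "(\<Sum>l\<in>UNIV. y $ l * pdy l (pdy k f) x y) = pdy k f x y"
    using homogD[OF homog_pdy[OF _ f] xy] by simp
  show ?thesis
    unfolding hdelta_def cov_deriv_def spray_deriv_proj_change sum_Nconn_proj_change[OF xy] 1 2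
    by (simp add: algebra_simps)
qed

text \<open>Taking the trace first avoids the full transformation rule of the Riemann curvature: \<open>\<Pi>\<close> changes
  by \<open>(n + 1) P\<close>, and the terms that \<open>P\<close> adds to the trace of \<open>N\<^sup>2\<close> are multiples of \<open>P \<Pi>\<close> and
  \<open>P\<^sup>2\<close>, and contractions with \<open>y\<close>, which Euler's identity evaluates.\<close>

lemma Ricci_proj_change:
  assumes xy [simp]: "x \<in> U" "y \<noteq> 0"
  shows "Ricci (proj_change G P) x y
    = Ricci G x y + (real CARD('n) - 1) * ((P x y)\<^sup>2 - spray_deriv G P x y)"
proof -
  interpret G': local_spray U "proj_change G P" by (rule local_spray_proj_change)
  let ?n = "real CARD('n)"
  define p where "p s = pdy s P x y" for s
  define N where "N i s = Nconn G i s x y" for i s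
  have P1: "(\<Sum>s\<in>UNIV. y $ s * p s) = P x y"
    unfolding p_def using homogD[OF homog_factor xy] by simp
  have N1: "(\<Sum>s\<in>UNIV. y $ s * N m s) = 2 * sprayc G m x y" for m
    unfolding N_def by (rule sum_Nconn_fibre[OF xy])
  have a: "(\<Sum>m\<in>UNIV. pdx m (sprayc (proj_change G P) m) x y)
    = (\<Sum>m\<in>UNIV. pdx m (sprayc G m) x y) + (\<Sum>m\<in>UNIV. y $ m * pdx m P x y)"
    unfolding sprayc_proj_change by (simp add: pd_simps sum.distrib mult.commute)
  have tr: "(\<Sum>m\<in>UNIV. Nconn (proj_change G P) m m x y) = trace_N x y + (?n + 1) * P x y"
    if "x \<in> U" "y \<noteq> 0" for x y
    using that homogD[OF homog_factor that]
    by (simp add: Nconn_proj_change sum.distrib trace_N_def algebra_simps)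
  have "homog 1 (\<lambda>x y. trace_N x y + (?n + 1) * P x y)"
    by (intro homog_add homog_cmult homog_trace_N homog_factor) simp_all
  from homogD[OF this xy]
  have "spray_deriv (proj_change G P) (\<lambda>x y. trace_N x y + (?n + 1) * P x y) x y
     = spray_deriv G trace_N x y + (?n + 1) * spray_deriv G P x y
       - 2 * P x y * (trace_N x y + (?n + 1) * P x y)"
    unfolding spray_deriv_proj_change by (simp add: spray_deriv_add spray_deriv_mult)
  moreover have "(\<Sum>m\<in>UNIV. spray_deriv (proj_change G P) (Nconn (proj_change G P) m m) x y)
    = spray_deriv (proj_change G P) (\<lambda>x y. trace_N x y + (?n + 1) * P x y) x y"
    using G'.spray_deriv_cong[OF xy, of "\<lambda>x y. \<Sum>m\<in>UNIV. Nconn (proj_change G P) m m x y"] tr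
    by (simp add: G'.spray_deriv_sum)
  ultimately have b: "(\<Sum>m\<in>UNIV. spray_deriv (proj_change G P) (Nconn (proj_change G P) m m) x y)
     = spray_deriv G trace_N x y + (?n + 1) * spray_deriv G P x y
       - 2 * P x y * (trace_N x y + (?n + 1) * P x y)" by simp
  have c: "(\<Sum>m\<in>UNIV. \<Sum>s\<in>UNIV. Nconn (proj_change G P) m s x y * Nconn (proj_change G P) s m x y)
    = (\<Sum>m\<in>UNIV. \<Sum>s\<in>UNIV. N m s * N s m) + 4 * (\<Sum>m\<in>UNIV. sprayc G m x y * p m)
      + 2 * P x y * trace_N x y + (?n + 3) * (P x y)\<^sup>2"
  proof -
    have inner: "(\<Sum>s\<in>UNIV. Nconn (proj_change G P) m s x y * Nconn (proj_change G P) s m x y)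
      = (\<Sum>s\<in>UNIV. N m s * N s m) + 2 * (sprayc G m x y * p m) + 2 * P x y * N m m
        + y $ m * (\<Sum>s\<in>UNIV. p s * N s m) + 3 * P x y * (y $ m * p m) + (P x y)\<^sup>2" for m
    proof -
      have "(\<Sum>s\<in>UNIV. Nconn (proj_change G P) m s x y * Nconn (proj_change G P) s m x y)
        = (\<Sum>s\<in>UNIV. Nconn (proj_change G P) s m x y * (N m s + p s * y $ m + P x y * (if m = s then 1 else 0)))"
        by (simp add: Nconn_proj_change N_def p_def mult.commute)
      also have "\<dots> = (\<Sum>s\<in>UNIV. N s m * (N m s + p s * y $ m)) + N m m * P x y
        + p m * ((\<Sum>s\<in>UNIV. y $ s * N m s) + (\<Sum>s\<in>UNIV. y $ s * p s) * y $ m + y $ m * P x y)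
        + P x y * (N m m + p m * y $ m + P x y)"
      proof -
        have K: "(\<Sum>s\<in>UNIV. B s * (P x y * (if m = s then 1 else 0))) = B m * P x y" for B :: "'n \<Rightarrow> real"
          using sum_Kronecker(4)[of "\<lambda>s. B s * P x y" m] by (simp add: mult.assoc)
        show ?thesis
          unfolding sum_Nconn_proj_change[OF xy] N_def[symmetric] p_def[symmetric] distrib_left[of "N _ _" "_ + _"]
            distrib_left[of "y $ _" "_ + _"] sum.distrib K
          by (simp add: distrib_left sum.distrib sum_distrib_left sum_distrib_right mult_ac)
      qed
      also have "\<dots> = (\<Sum>s\<in>UNIV. N m s * N s m) + 2 * (sprayc G m x y * p m) + 2 * P x y * N m m
        + y $ m * (\<Sum>s\<in>UNIV. p s * N s m) + 3 * P x y * (y $ m * p m) + (P x y)\<^sup>2"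
        unfolding N1 P1
        by (simp add: algebra_simps sum.distrib sum_distrib_left power2_eq_square)
      finally show ?thesis .
    qed
    have "(\<Sum>m\<in>UNIV. y $ m * (\<Sum>s\<in>UNIV. p s * N s m)) = (\<Sum>s\<in>UNIV. p s * (\<Sum>m\<in>UNIV. y $ m * N s m))"
      unfolding sum_distrib_left by (subst sum.swap) (simp add: mult_ac)
    then have "(\<Sum>m\<in>UNIV. y $ m * (\<Sum>s\<in>UNIV. p s * N s m)) = 2 * (\<Sum>m\<in>UNIV. sprayc G m x y * p m)"
      unfolding N1 by (simp add: sum_distrib_left mult_ac)
    then show ?thesis
      unfolding inner sum.distrib
      by (simp add: sum_distrib_left[symmetric] P1 trace_N_def N_def mult.assoc) (simp add: algebra_simps power2_eq_square)
  qed
  have d: "spray_deriv G trace_N x y = (\<Sum>m\<in>UNIV. spray_deriv G (Nconn G m m) x y)"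
    by (simp add: trace_N_def spray_deriv_sum)
  show ?thesis
    unfolding Ricci_def Riem_spray_deriv G'.Riem_spray_deriv sum_subtractf sum_distrib_left[symmetric] a b c d
    by (simp add: N_def p_def spray_deriv_def[of _ P] algebra_simps power2_eq_square)
qed

end

section \<open>The Berwald-Weyl curvature\<close>

lemma Berwald_Weyl_formula:
  fixes \<sigma> :: "real ^ 'n \<Rightarrow> real"
  assumes smooth_ln: "smooth (\<lambda>x y. ln (\<sigma> x))" and xy [simp]: "x \<in> U" "y \<noteq> 0" and n: "CARD('n) \<ge> 2"
  shows "Berwald_Weyl G \<sigma> k x y =
      hcov0 G (Ricci_scalar G) k x y
    - 1/2 * (\<Sum>m\<in>UNIV. hcov1 G (\<lambda>j. pdy j (Ricci_scalar G)) k m x y * y $ m)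
    - 1 / (real CARD('n) + 1) * (\<Sum>m\<in>UNIV. hcov1 G (chi_curv G) k m x y * y $ m)
    - 1 / (real CARD('n) + 1) *
        (\<Sum>m\<in>UNIV. Weyl_curv G m k x y * pdy m (S_curv G \<sigma>) x y)"
proof -
  let ?n = "real CARD('n)"
  let ?S = "S_curv G \<sigma>"
  let ?R = "Ricci_scalar G"
  define a where "a = - (1 / (?n + 1))"
  define P where "P = (\<lambda>x y. a * ?S x y)"
  have S [simp]: "smooth ?S" by (rule smooth_S_curv[OF smooth_ln])
  have P [simp]: "smooth P" and P1: "homog 1 P"
    unfolding P_def by (intro smooth_mult smooth_const S, intro homog_cmult homog_S_curv smooth_ln S)
  define G' where "G' = proj_change G P"
  interpret G': local_spray U G'
    unfolding G'_def by (rule local_spray_proj_change[OF P P1])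
  have G': "projective_spray G \<sigma> = G'"
    by (simp only: projective_spray_eq_proj_change G'_def P_def a_def)
  define \<Xi> where "\<Xi> = (\<lambda>x y. P x y * P x y - spray_deriv G P x y)"
  define q where "q = cov_deriv G (\<lambda>j. pdy j P)"
  have [simp]: "smooth (q j)" for j by (simp add: q_def)
  have \<Xi> [simp]: "smooth \<Xi>" by (simp add: \<Xi>_def)
  \<comment> \<open>here \<open>n - 1\<close> is cancelled, so \<open>n\<close> must not be one\<close>
  have R': "Ricci_scalar G' x y = ?R x y + \<Xi> x y" if "x \<in> U" "y \<noteq> 0" for x y
    using Ricci_proj_change[OF P P1 that] n
    by (simp add: G'_def Ricci_scalar_def \<Xi>_def add_divide_distrib power2_eq_square)

  have chi: "chi_curv G k x y = - ((?n + 1) / 2) * (q k x y - hdelta G k P x y)" if "x \<in> U" "y \<noteq> 0" for k x y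
  proof -
    have "q k x y = cov_deriv G (\<lambda>j x y. a * pdy j ?S x y) k x y"
      unfolding q_def P_def by (intro cov_deriv_cong that) (simp add: pd_simps)
    also have "\<dots> = a * cov_deriv G (\<lambda>j. pdy j ?S) k x y"
      using cov_deriv_mult[of "\<lambda>x y. a" "\<lambda>j. pdy j ?S" x y k] that by simp
    finally have 1: "q k x y = \<dots>" .
    have 2: "hdelta G k P x y = a * hdelta G k ?S x y"
      using hdelta_mult[of "\<lambda>x y. a" ?S x y k] that by (simp add: P_def)
    have a1: "(?n + 1) * a = - 1"
      by (simp add: a_def add_nonneg_eq_0_iff)
    have "- ((?n + 1) / 2) * (a * u - a * v) = - (1/2) * ((?n + 1) * a) * (u - v)" for u v
      by (simp add: field_simps)
    then show ?thesis
      unfolding chi_curv_S_curv[OF smooth_ln that n] 1 2 a1 by simp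
  qed
  have "cov_deriv G (chi_curv G) k x y
    = cov_deriv G (\<lambda>k x y. - ((?n + 1) / 2) * (q k x y - hdelta G k P x y)) k x y"
    by (intro cov_deriv_cong xy chi)
  also have "\<dots> = - ((?n + 1) / 2) * cov_deriv G (\<lambda>k x y. q k x y - hdelta G k P x y) k x y"
    using cov_deriv_mult[of "\<lambda>x y. - ((?n + 1) / 2)" "\<lambda>k x y. q k x y - hdelta G k P x y" x y k] by simp
  finally have cov_chi: "1 / (?n + 1) * cov_deriv G (chi_curv G) k x y
    = - 1/2 * cov_deriv G (\<lambda>k x y. q k x y - hdelta G k P x y) k x y"
    by (simp add: field_simps)
  have "3 * (- (r / 2) * X) / r = - 3/2 * X" if "r \<noteq> 0" for r X :: real
    using that by simp
  from this[of "?n + 1" "q k x y - hdelta G k P x y"]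
  have chi3: "3 * chi_curv G k x y / (?n + 1) = - 3/2 * (q k x y - hdelta G k P x y)"
    unfolding chi[OF xy] by (simp add: add_nonneg_eq_0_iff)
  have PS: "1 / (?n + 1) * pdy m ?S x y = - pdy m P x y" for m
    by (simp add: P_def a_def[symmetric] pd_simps) (simp add: a_def)
  have "1 / (?n + 1) * (\<Sum>m\<in>UNIV. Weyl_curv G m k x y * pdy m ?S x y)
    = - (\<Sum>m\<in>UNIV. Weyl_curv G m k x y * pdy m P x y)"
    unfolding sum_distrib_left mult.left_commute[of "1 / (?n + 1)"] PS by (simp add: sum_negf)
  also have "(\<Sum>m\<in>UNIV. Weyl_curv G m k x y * pdy m P x y)
    = (\<Sum>m\<in>UNIV. Riem G m k x y * pdy m P x y) - ?R x y * pdy k P x y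
      + (1/2 * pdy k ?R x y + 3 * chi_curv G k x y / (?n + 1)) * (\<Sum>m\<in>UNIV. y $ m * pdy m P x y)"
  proof -
    have "(\<Sum>m\<in>UNIV. ?R x y * (if m = k then 1 else 0) * pdy m P x y) = ?R x y * pdy k P x y"
      using sum_Kronecker(1)[of k "\<lambda>m. ?R x y * pdy m P x y"] by (simp add: mult_ac)
    then show ?thesis
      unfolding Weyl_curv_def distrib_right left_diff_distrib sum.distrib sum_subtractf sum_distrib_left
      by (simp add: mult_ac)
  qed
  also have "(\<Sum>m\<in>UNIV. y $ m * pdy m P x y) = P x y"
    using homogD[OF P1 xy] by simp
  finally have weyl: "1 / (?n + 1) * (\<Sum>m\<in>UNIV. Weyl_curv G m k x y * pdy m ?S x y)
    = - ((\<Sum>m\<in>UNIV. Riem G m k x y * pdy m P x y) - ?R x y * pdy k P x y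
      + (1/2 * pdy k ?R x y - 3/2 * (q k x y - hdelta G k P x y)) * P x y)"
    unfolding chi3 by simp

  \<comment> \<open>stated for any spray, to serve \<open>G\<close> and its projective change\<close>
  have BW: "hcov0 H f k x y - 1/2 * (\<Sum>m\<in>UNIV. hcov1 H (\<lambda>j. pdy j f) k m x y * y $ m)
    = hdelta H k f x y - 1/2 * cov_deriv H (\<lambda>j. pdy j f) k x y" if "local_spray U H" for H f
    by (simp add: hcov0_def local_spray.hcov1_fibre[OF that])
  have pR': "pdy j (\<lambda>x y. ?R x y + \<Xi> x y) x y = pdy j ?R x y + pdy j \<Xi> x y" if "x \<in> U" "y \<noteq> 0" for j x y
    using that by (simp add: pd_simps)
  have "homog 2 \<Xi>"
    using homog_mult[OF P P P1 P1] homog_spray_deriv[OF P P1]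
    unfolding \<Xi>_def by (intro homog_diff) simp_all
  then have R2: "homog 2 (\<lambda>x y. ?R x y + \<Xi> x y)"
    by (intro homog_add homog_Ricci_scalar) simp_all
  have "Berwald_Weyl G \<sigma> k x y
    = hdelta G' k (Ricci_scalar G') x y - 1/2 * cov_deriv G' (\<lambda>j. pdy j (Ricci_scalar G')) k x y"
    unfolding Berwald_Weyl_def G' Let_def by (rule BW[OF G'.local_spray_axioms])
  also have "\<dots> = hdelta G' k (\<lambda>x y. ?R x y + \<Xi> x y) x y
      - 1/2 * cov_deriv G' (\<lambda>j. pdy j (\<lambda>x y. ?R x y + \<Xi> x y)) k x y"
    by (intro arg_cong2[where f = "(-)"] arg_cong[where f = "(*) (1/2)"]
        G'.hdelta_cong G'.cov_deriv_cong pdy_cong xy R')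
  also have "\<dots> = hdelta G k (\<lambda>x y. ?R x y + \<Xi> x y) x y
      - 1/2 * cov_deriv G (\<lambda>j. pdy j (\<lambda>x y. ?R x y + \<Xi> x y)) k x y
      + 1/2 * P x y * pdy k (\<lambda>x y. ?R x y + \<Xi> x y) x y - pdy k P x y * (?R x y + \<Xi> x y)"
    unfolding G'_def by (rule Berwald_Weyl_operator_proj_change[OF P P1 xy _ R2]) simp
  also have "cov_deriv G (\<lambda>j. pdy j (\<lambda>x y. ?R x y + \<Xi> x y)) k x y
     = cov_deriv G (\<lambda>j. pdy j ?R) k x y + cov_deriv G (\<lambda>j. pdy j \<Xi>) k x y"
    by (subst cov_deriv_cong[OF xy pR']) (simp_all add: cov_deriv_add)
  also have "pdy k (\<lambda>x y. ?R x y + \<Xi> x y) x y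
      = pdy k ?R x y + 2 * P x y * pdy k P x y - (q k x y + hdelta G k P x y)"
    unfolding \<Xi>_def q_def by (simp add: pd_simps pdy_spray_deriv_cov)
  also have "hdelta G k (\<lambda>x y. ?R x y + \<Xi> x y) x y = hdelta G k ?R x y + hdelta G k \<Xi> x y"
    by (simp add: hdelta_add)
  finally have "Berwald_Weyl G \<sigma> k x y =
      hdelta G k ?R x y - 1/2 * cov_deriv G (\<lambda>j. pdy j ?R) k x y
      + (hdelta G k \<Xi> x y - 1/2 * cov_deriv G (\<lambda>j. pdy j \<Xi>) k x y)
      + 1/2 * P x y * (pdy k ?R x y + 2 * P x y * pdy k P x y - (q k x y + hdelta G k P x y))
      - pdy k P x y * (?R x y + \<Xi> x y)"
    by (simp add: algebra_simps)
  then show ?thesis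
    unfolding BW[OF local_spray_axioms] hcov1_fibre[OF xy, of "chi_curv G"] cov_chi weyl
      Berwald_Weyl_operator_riccati[OF P xy, of k, folded \<Xi>_def q_def]
    by (simp add: \<Xi>_def algebra_simps)
qed

end

text \<open>The smooth vector field has the fibre components \<open>- 2 G\<^sup>i\<close>, whence the factor \<open>- 1/2\<close> in the
  projection to \<open>G\<^sup>i\<close>.\<close>

lemma local_spray_chart:
  fixes c :: "('a, 'n::finite) chart"
  assumes "open (snd c ` fst c)" "is_spray A G" "c \<in> A"
  shows "local_spray (snd c ` fst c) (G c)"
proof -
  let ?U = "snd c ` fst c"
  interpret punctured_tangent ?U by unfold_locales (rule assms(1))
  have sm: "smooth (sprayc (G c) i)" for i
  proof -
    have L: "bounded_linear (\<lambda>p :: (real ^ 'n) \<times> (real ^ 'n). - (1/2) * (snd p $ i))"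
      by (intro bounded_linear_const_mult bounded_linear_compose[OF bounded_linear_vec_nth bounded_linear_snd])
    have "smooth_on (?U \<times> - {0}) (\<lambda>(x, y). (y, - 2 *\<^sub>R G c x y))"
      using assms(2,3) unfolding is_spray_def smooth_vector_field_TM0_def by blast
    from smooth_onI[OF Ck_on_bounded_linear_comp[OF L open_domain smooth_onD[OF this]]]
    show ?thesis by (simp add: smooth_tfun_def sprayc_def split_def)
  qed
  show ?thesis
  proof unfold_locales
    fix i
    show "smooth (sprayc (G c) i)" by (rule sm)
    show "homog 2 (sprayc (G c) i)"
      using homogI[OF sm, of i 2] assms(2,3) unfolding is_spray_def by (auto simp: sprayc_def)
  qed
qed

theorem proposition1p3:
  fixes M :: "'a topology"
    and A :: "('a, 'n::finite) chart set"
    and G :: "('a, 'n) chart \<Rightarrow> real ^ 'n \<Rightarrow> real ^ 'n \<Rightarrow> real ^ 'n"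
    and \<sigma> :: "('a, 'n) chart \<Rightarrow> real ^ 'n \<Rightarrow> real"
    and c :: "('a, 'n) chart"
    and x y :: "real ^ 'n"
    and k :: 'n
  assumes "CARD('n) \<ge> 2"
    and "smooth_manifold M A"
    and "is_spray A G"
    and "is_volume_form A \<sigma>"
    and "c \<in> A"
    and "x \<in> snd c ` fst c"
    and "y \<noteq> 0"
  shows "Berwald_Weyl (G c) (\<sigma> c) k x y =
      hcov0 (G c) (Ricci_scalar (G c)) k x y
    - 1/2 * (\<Sum>m\<in>UNIV. hcov1 (G c) (\<lambda>j. pdy j (Ricci_scalar (G c))) k m x y * y $ m)
    - 1 / (real CARD('n) + 1) * (\<Sum>m\<in>UNIV. hcov1 (G c) (chi_curv (G c)) k m x y * y $ m)
    - 1 / (real CARD('n) + 1) *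
        (\<Sum>m\<in>UNIV. Weyl_curv (G c) m k x y * pdy m (S_curv (G c) (\<sigma> c)) x y)"
proof -
  have U: "open (snd c ` fst c)"
    using assms(2,5) unfolding smooth_manifold_def is_chart_def by blast
  interpret local_spray "snd c ` fst c" "G c"
    by (rule local_spray_chart[OF U assms(3,5)])
  have sm: "smooth_on (snd c ` fst c) (\<sigma> c)" and pos: "\<And>x. x \<in> snd c ` fst c \<Longrightarrow> \<sigma> c x > 0"
    using assms(4,5) unfolding is_volume_form_def by blast+
  have "smooth_on (snd c ` fst c) (\<lambda>x. ln (\<sigma> c x))"
    by (rule smooth_onI, rule Ck_on_ln[OF U pos smooth_onD[OF sm]])
  from Berwald_Weyl_formula[OF smooth_base[OF this] assms(6,7,1)] show ?thesis .
qed

end
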